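(* If reachability on factored graphs is not fixed parameter tractable, then there is no constant $C$ such that ${\bf NL}\subseteq {\bf DTIME}(n^C)$.
   Context: All graphs are directed. For directed graphs $G,H$: the Cartesian product $G\,\square\,H$ has vertex set $V(G)\times V(H)$ and an edge $((v_1,u_1),(v_2,u_2))$ iff either $v_1=v_2$ and $(u_1,u_2)\in E(H)$, or $u_1=u_2$ and $(v_1,v_2)\in E(G)$; the tensor product $G\times H$ has vertex set $V(G)\times V(H)$ and an edge iff $(v_1,v_2)\in E(G)$ and $(u_1,u_2)\in E(H)$; the union $G\cup H$ has vertex set $V(G)\cup V(H)$ and edge set $E(G)\cup E(H)$. Vertices of products are flattened tuples, so products are associative. A factored graph $G=f(G_1,\dots,G_m)$ is given by a formula $f$ built from explicitly given input graphs using these operations and parentheses; it has complexity $(n,k)$ if $f$ uses $k-1$ operations and each input graph has at most $n$ vertices. The reachability problem: given a factored graph $G$ and vertices $s,t$, decide whether there is a directed path from $s$ to $t$ in $G$. Reachability is fixed parameter tractable if it can be solved on factored graphs of complexity $(n,k)$ in time $O(g(k)n^C)$ for some function $g$ and absolute constant $C$ independent of $k$. ${\bf NL}$ is the class of languages decidable by nondeterministic Turing machines in logarithmic space. *)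

theory Defs
  imports "Graph_Theory.Pair_Digraph" "HOL-Library.Landau_Symbols" Complex_Main
begin

section \<open>Factored graphs\<close>

text \<open>
  A vertex of a factored graph is a flattened tuple, i.e. a list, of vertices of the input graphs.
  Products are taken up to this flattening, so that they are associative.  Loops are allowed.
\<close>

definition cartesian_product ::
  "'a list pair_pre_digraph \<Rightarrow> 'a list pair_pre_digraph \<Rightarrow> 'a list pair_pre_digraph" where
  "cartesian_product G H =
     \<lparr> pverts = {v @ u | v u. v \<in> pverts G \<and> u \<in> pverts H},
       parcs = {(v1 @ u1, v2 @ u2) | v1 u1 v2 u2.
                  v1 \<in> pverts G \<and> v2 \<in> pverts G \<and> u1 \<in> pverts H \<and> u2 \<in> pverts H \<and>
                  (v1 = v2 \<and> (u1, u2) \<in> parcs H \<or> u1 = u2 \<and> (v1, v2) \<in> parcs G)} \<rparr>"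

definition tensor_product ::
  "'a list pair_pre_digraph \<Rightarrow> 'a list pair_pre_digraph \<Rightarrow> 'a list pair_pre_digraph" where
  "tensor_product G H =
     \<lparr> pverts = {v @ u | v u. v \<in> pverts G \<and> u \<in> pverts H},
       parcs = {(v1 @ u1, v2 @ u2) | v1 u1 v2 u2. (v1, v2) \<in> parcs G \<and> (u1, u2) \<in> parcs H} \<rparr>"

definition graph_union ::
  "'a pair_pre_digraph \<Rightarrow> 'a pair_pre_digraph \<Rightarrow> 'a pair_pre_digraph" where
  "graph_union G H = \<lparr> pverts = pverts G \<union> pverts H, parcs = parcs G \<union> parcs H \<rparr>"

datatype factored =
    Input "nat pair_pre_digraph"
  | Cartesian factored factored
  | Tensor factored factored
  | Union factored factored

fun graph_of :: "factored \<Rightarrow> nat list pair_pre_digraph" where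
  "graph_of (Input G) =
     \<lparr> pverts = (\<lambda>v. [v]) ` pverts G, parcs = (\<lambda>(u, v). ([u], [v])) ` parcs G \<rparr>"
| "graph_of (Cartesian F H) = cartesian_product (graph_of F) (graph_of H)"
| "graph_of (Tensor F H) = tensor_product (graph_of F) (graph_of H)"
| "graph_of (Union F H) = graph_union (graph_of F) (graph_of H)"

fun inputs :: "factored \<Rightarrow> nat pair_pre_digraph set" where
  "inputs (Input G) = {G}"
| "inputs (Cartesian F H) = inputs F \<union> inputs H"
| "inputs (Tensor F H) = inputs F \<union> inputs H"
| "inputs (Union F H) = inputs F \<union> inputs H"

fun num_operations :: "factored \<Rightarrow> nat" where
  "num_operations (Input G) = 0"
| "num_operations (Cartesian F H) = Suc (num_operations F + num_operations H)"
| "num_operations (Tensor F H) = Suc (num_operations F + num_operations H)"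
| "num_operations (Union F H) = Suc (num_operations F + num_operations H)"

definition has_complexity :: "factored \<Rightarrow> nat \<Rightarrow> nat \<Rightarrow> bool" where
  "has_complexity F n k \<longleftrightarrow>
     k \<ge> 1 \<and> num_operations F = k - 1 \<and> (\<forall>G\<in>inputs F. card (pverts G) \<le> n)"

definition labels :: "factored \<Rightarrow> nat set" where
  "labels F = (\<Union>G\<in>inputs F. pverts G)"

text \<open>
  The input vertices are numbered \<open>0, \<dots>, N - 1\<close>, where \<open>N\<close> is the number of distinct vertices
  of the input graphs.  This only fixes their names, and every factored graph can be renamed this
  way.  A convention of this kind is needed because running times are measured in \<open>n\<close> and \<open>k\<close>
  alone, and these do not bound the length of arbitrary names.
\<close>

definition factored_graph :: "factored \<Rightarrow> bool" where
  "factored_graph F \<longleftrightarrow>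
     (\<forall>G\<in>inputs F. pair_fin_digraph G) \<and> labels F = {..<card (labels F)}"

definition reachability_instance :: "nat \<Rightarrow> nat \<Rightarrow> factored \<Rightarrow> nat list \<Rightarrow> nat list \<Rightarrow> bool" where
  "reachability_instance n k F s t \<longleftrightarrow>
     factored_graph F \<and> has_complexity F n k \<and>
     s \<in> pverts (graph_of F) \<and> t \<in> pverts (graph_of F)"


section \<open>Encoding of instances as binary words\<close>

text \<open>
  Formulas are written in prefix notation.  An input graph is given by its vertex list and its arc
  list, numbers are given in binary with the least significant bit first, and every token is
  written as a block of three bits.
\<close>

datatype token = Bit bool | Sep | End | InputT | CartesianT | TensorT | UnionT

fun token_code :: "token \<Rightarrow> bool list" where
  "token_code (Bit b) = [False, False, b]"
| "token_code Sep = [False, True, False]"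
| "token_code End = [False, True, True]"
| "token_code InputT = [True, False, False]"
| "token_code CartesianT = [True, False, True]"
| "token_code TensorT = [True, True, False]"
| "token_code UnionT = [True, True, True]"

fun binary :: "nat \<Rightarrow> bool list" where
  "binary n = (if n = 0 then [] else odd n # binary (n div 2))"

declare binary.simps [simp del]

definition number_tokens :: "nat \<Rightarrow> token list" where
  "number_tokens n = map Bit (binary n) @ [Sep]"

definition list_tokens :: "nat list \<Rightarrow> token list" where
  "list_tokens ns = concat (map number_tokens ns) @ [End]"

definition vertex_list :: "nat pair_pre_digraph \<Rightarrow> nat list" where
  "vertex_list G = sorted_list_of_set (pverts G)"

definition arc_list :: "nat pair_pre_digraph \<Rightarrow> (nat \<times> nat) list" where
  "arc_list G = filter (\<lambda>e. e \<in> parcs G) (List.product (vertex_list G) (vertex_list G))"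

fun factored_tokens :: "factored \<Rightarrow> token list" where
  "factored_tokens (Input G) =
     InputT # list_tokens (vertex_list G)
       @ list_tokens (concat (map (\<lambda>(u, v). [u, v]) (arc_list G)))"
| "factored_tokens (Cartesian F H) = CartesianT # factored_tokens F @ factored_tokens H"
| "factored_tokens (Tensor F H) = TensorT # factored_tokens F @ factored_tokens H"
| "factored_tokens (Union F H) = UnionT # factored_tokens F @ factored_tokens H"

definition encode :: "factored \<Rightarrow> nat list \<Rightarrow> nat list \<Rightarrow> bool list" where
  "encode F s t =
     concat (map token_code (factored_tokens F @ list_tokens s @ list_tokens t))"


section \<open>Turing machines\<close>

text \<open>
  Multitape machines with a read-only two-way input tape and any fixed number of one-way infinite
  work tapes.  The input word occupies the cells \<open>1, \<dots>, length x\<close> of the input tape, between two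
  end markers which the input head cannot leave.  A head that moves left from cell \<open>0\<close> stays there.
\<close>

datatype dir = MoveLeft | Stay | MoveRight

datatype input_symbol = LeftEnd | Letter bool | RightEnd

record ('q, 's) tm =
  num_tapes :: nat
  start :: 'q
  accept :: 'q
  blank :: 's
  trans :: "(('q \<times> input_symbol \<times> 's list) \<times> ('q \<times> dir \<times> ('s \<times> dir) list)) set"

text \<open>Finiteness of \<open>trans\<close> makes the state set and the tape alphabet finite.\<close>

definition turing_machine :: "('q, 's) tm \<Rightarrow> bool" where
  "turing_machine M \<longleftrightarrow>
     finite (trans M) \<and>
     (\<forall>((q, a, rs), (q', d, ws))\<in>trans M.
        length rs = num_tapes M \<and> length ws = num_tapes M)"

definition deterministic :: "('q, 's) tm \<Rightarrow> bool" where
  "deterministic M \<longleftrightarrow> single_valued (trans M)"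

record ('q, 's) config =
  state :: 'q
  input_head :: nat
  work :: "((nat \<Rightarrow> 's) \<times> nat) list"

definition read_input :: "bool list \<Rightarrow> nat \<Rightarrow> input_symbol" where
  "read_input x i =
     (if i = 0 then LeftEnd else if i \<le> length x then Letter (x ! (i - 1)) else RightEnd)"

fun move :: "dir \<Rightarrow> nat \<Rightarrow> nat" where
  "move MoveLeft i = i - 1"
| "move Stay i = i"
| "move MoveRight i = Suc i"

definition initial :: "('q, 's) tm \<Rightarrow> ('q, 's) config" where
  "initial M = \<lparr> state = start M, input_head = 0,
                 work = replicate (num_tapes M) (\<lambda>_. blank M, 0) \<rparr>"

definition steps :: "('q, 's) tm \<Rightarrow> bool list \<Rightarrow> ('q, 's) config rel" where
  "steps M x = {(c, c'). \<exists>d ws.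
     ((state c, read_input x (input_head c), map (\<lambda>(f, h). f h) (work c)),
      (state c', d, ws)) \<in> trans M \<and>
     input_head c' = min (move d (input_head c)) (Suc (length x)) \<and>
     work c' = map2 (\<lambda>(f, h) (a, e). (f(h := a), move e h)) (work c) ws}"

definition halted :: "('q, 's) tm \<Rightarrow> bool list \<Rightarrow> ('q, 's) config \<Rightarrow> bool" where
  "halted M x c \<longleftrightarrow> c \<notin> Domain (steps M x)"

definition halts_in :: "('q, 's) tm \<Rightarrow> bool list \<Rightarrow> nat \<Rightarrow> bool" where
  "halts_in M x j \<longleftrightarrow> (\<exists>c. (initial M, c) \<in> steps M x ^^ j \<and> halted M x c)"

definition accepts :: "('q, 's) tm \<Rightarrow> bool list \<Rightarrow> bool" where
  "accepts M x \<longleftrightarrow> (\<exists>c. (initial M, c) \<in> (steps M x)\<^sup>* \<and> halted M x c \<and> state c = accept M)"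

text \<open>Only the cells of the work tapes count as space, and the bound holds on every branch.\<close>

definition uses_space :: "('q, 's) tm \<Rightarrow> bool list \<Rightarrow> nat \<Rightarrow> bool" where
  "uses_space M x b \<longleftrightarrow>
     (\<forall>c. (initial M, c) \<in> (steps M x)\<^sup>* \<longrightarrow> (\<forall>(f, h)\<in>set (work c). h < b))"


section \<open>Complexity classes\<close>

definition DTIME :: "(nat \<Rightarrow> real) \<Rightarrow> bool list set set" where
  "DTIME f = {L. \<exists>(M :: (nat, nat) tm) T.
     turing_machine M \<and> deterministic M \<and> (\<lambda>n. real (T n)) \<in> O(f) \<and>
     (\<forall>x. (\<exists>j\<le>T (length x). halts_in M x j) \<and> (x \<in> L \<longleftrightarrow> accepts M x))}"

text \<open>
  Branches of a space-bounded nondeterministic machine are not required to halt.  For logarithmic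
  space this gives the same class, since a step counter of logarithmic length can be added.
\<close>

definition NSPACE :: "(nat \<Rightarrow> real) \<Rightarrow> bool list set set" where
  "NSPACE f = {L. \<exists>(M :: (nat, nat) tm) S.
     turing_machine M \<and> (\<lambda>n. real (S n)) \<in> O(f) \<and>
     (\<forall>x. uses_space M x (S (length x)) \<and> (x \<in> L \<longleftrightarrow> accepts M x))}"

definition NL :: "bool list set set" where
  "NL = NSPACE (\<lambda>n. ln (real n))"


section \<open>Fixed parameter tractability of reachability\<close>

text \<open>
  The function \<open>g\<close> is arbitrary and the algorithm may depend on \<open>k\<close>, whereas the exponent \<open>C\<close> may
  not.  The constant hidden in \<open>O(g(k) n\<^sup>C)\<close> is absorbed into \<open>g\<close>.  Every instance has \<open>n \<ge> 1\<close>,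
  because \<open>s\<close> is a vertex.
\<close>

definition solves_reachability_in_time :: "('q, 's) tm \<Rightarrow> nat \<Rightarrow> (nat \<Rightarrow> real) \<Rightarrow> bool" where
  "solves_reachability_in_time M k T \<longleftrightarrow>
     (\<forall>n F s t. reachability_instance n k F s t \<longrightarrow>
        (\<exists>j. real j \<le> T n \<and> halts_in M (encode F s t) j) \<and>
        (accepts M (encode F s t) \<longleftrightarrow> s \<rightarrow>\<^sup>*\<^bsub>with_proj (graph_of F)\<^esub> t))"

definition reachability_fixed_parameter_tractable :: bool where
  "reachability_fixed_parameter_tractable \<longleftrightarrow>
     (\<exists>(C :: real) (g :: nat \<Rightarrow> real). \<forall>k. \<exists>M :: (nat, nat) tm.
        turing_machine M \<and> deterministic M \<and>
        solves_reachability_in_time M k (\<lambda>n. g k * real n powr C))"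

end

theory Submission
  imports Defs "HOL-Library.Countable" "HOL-Library.Sublist"
begin

text \<open>
  For every fixed \<open>k\<close>, reachability on factored graphs given by \<open>k - 1\<close> operations is decided by a
  nondeterministic machine in logarithmic space: keep the current vertex, a tuple of at most \<open>k\<close>
  numbers, as pointers to occurrences of these numbers in the input, and follow an arc by one pass
  over the formula, which guesses the next vertex and redirects the pointers at the input graphs.
  In a Cartesian product one operand has to make a step and the other one has to contain the
  vertex, in a tensor product both have to make a step, and in a union one of them does while the
  other one is skipped.  If \<open>NL\<close> is contained in \<open>DTIME(n\<^sup>C)\<close> with \<open>C \<ge> 0\<close>, then this language is
  decided deterministically in time \<open>O(N\<^sup>C)\<close> on words of length \<open>N\<close>.  As an instance has length
  \<open>O(k\<^sup>2 n\<^sup>3)\<close>, the exponent of \<open>n\<close> becomes \<open>3C\<close>, whatever \<open>k\<close> is.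

  The machines are obtained from nondeterministic regular programs by two compilation steps.  The
  registers of the upper level hold suffixes of the token sequence, those of the lower level hold
  cell numbers, which the machine stores in binary as the tracks of a single tape.
\<close>

section \<open>Nondeterministic regular programs\<close>

datatype 'a prog = Atom 'a | Fail | Seq "'a prog" "'a prog" | Choice "'a prog" "'a prog" | Star "'a prog"

instance prog :: (countable) countable by countable_datatype

fun sem :: "('a \<Rightarrow> 's rel) \<Rightarrow> 'a prog \<Rightarrow> 's rel" where
  "sem act (Atom a) = act a"
| "sem act Fail = {}"
| "sem act (Seq p q) = sem act p O sem act q"
| "sem act (Choice p q) = sem act p \<union> sem act q"
| "sem act (Star p) = (sem act p)\<^sup>*"

fun seqs :: "'a prog list \<Rightarrow> 'a prog" where
  "seqs [] = Star Fail"
| "seqs [p] = p"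
| "seqs (p # ps) = Seq p (seqs ps)"

definition choices :: "'a prog list \<Rightarrow> 'a prog" where
  "choices ps = foldr Choice ps Fail"

lemma sem_choices: "sem act (choices ps) = (\<Union>p\<in>set ps. sem act p)"
  by (induction ps) (auto simp: choices_def)

fun expand :: "'a prog list \<Rightarrow> 'a prog list set" where
  "expand (Seq p q # K) = {p # q # K}"
| "expand (Choice p q # K) = {p # K, q # K}"
| "expand (Star p # K) = {K, p # Star p # K}"
| "expand K = {}"

definition prog_step :: "('a \<Rightarrow> 's rel) \<Rightarrow> ('a prog list \<times> 's) rel" where
  "prog_step act = {((K, s), (K', s)) | K K' s. K' \<in> expand K} \<union>
     {((Atom a # K, s), (K, s')) | a K s s'. (s, s') \<in> act a}"

fun sem_list :: "('a \<Rightarrow> 's rel) \<Rightarrow> 'a prog list \<Rightarrow> 's rel" where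
  "sem_list act [] = Id"
| "sem_list act (p # K) = sem act p O sem_list act K"

lemma expand_sem_list: "K' \<in> expand K \<Longrightarrow> sem_list act K' \<subseteq> sem_list act K"
proof (induction K rule: expand.induct)
  case (3 p K)
  then show ?case
    by (auto simp: relcomp.simps) (blast intro: converse_rtrancl_into_rtrancl)
qed auto

lemma prog_steps_sound:
  "((K, s), ([], s')) \<in> (prog_step act)\<^sup>* \<Longrightarrow> (s, s') \<in> sem_list act K"
proof (induction "(K, s)" arbitrary: K s rule: converse_rtrancl_induct)
  case base
  then show ?case by simp
next
  case (step c)
  obtain K1 s1 where c: "c = (K1, s1)" by fastforce
  then have IH: "(s1, s') \<in> sem_list act K1" using step by blast
  from step(1) c show ?case
    unfolding prog_step_def using IH expand_sem_list[of K1 K act] by auto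
qed

lemma prog_steps_complete:
  "(s, s') \<in> sem act p \<Longrightarrow> ((p # K, s), (K, s')) \<in> (prog_step act)\<^sup>*"
proof (induction p arbitrary: s s' K)
  case (Atom a)
  then show ?case by (auto simp: prog_step_def)
next
  case (Seq p q)
  then obtain t where "(s, t) \<in> sem act p" "(t, s') \<in> sem act q" by auto
  then have "((p # q # K, s), (K, s')) \<in> (prog_step act)\<^sup>*"
    using Seq.IH by (meson rtrancl_trans)
  moreover have "((Seq p q # K, s), (p # q # K, s)) \<in> prog_step act"
    by (auto simp: prog_step_def)
  ultimately show ?case by (rule converse_rtrancl_into_rtrancl[rotated])
next
  case (Choice p q)
  have "((Choice p q # K, s), (p # K, s)) \<in> prog_step act"
    "((Choice p q # K, s), (q # K, s)) \<in> prog_step act"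
    by (auto simp: prog_step_def)
  with Choice show ?case by (auto intro: converse_rtrancl_into_rtrancl)
next
  case (Star p)
  have 1: "((Star p # K, t), (K, t)) \<in> prog_step act" for t
    by (auto simp: prog_step_def)
  have 2: "((Star p # K, t), (p # Star p # K, t)) \<in> prog_step act" for t
    by (auto simp: prog_step_def)
  from Star.prems have "(s, s') \<in> (sem act p)\<^sup>*" by simp
  then show ?case
  proof (induction rule: converse_rtrancl_induct)
    case base
    show ?case using 1 by blast
  next
    case (step y z)
    then show ?case using 2 Star.IH by (meson converse_rtrancl_into_rtrancl rtrancl_trans)
  qed
qed simp

lemma prog_steps_iff:
  "((([p], s), ([], s')) \<in> (prog_step act)\<^sup>*) \<longleftrightarrow> (s, s') \<in> sem act p"
  using prog_steps_sound[of "[p]" s s' act] prog_steps_complete[of s s' act p "[]"] by auto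

fun conts :: "'a prog \<Rightarrow> 'a prog list set" where
  "conts (Atom a) = {[Atom a]}"
| "conts Fail = {[Fail]}"
| "conts (Seq p q) = {[Seq p q]} \<union> (\<lambda>K. K @ [q]) ` conts p \<union> conts q"
| "conts (Choice p q) = {[Choice p q]} \<union> conts p \<union> conts q"
| "conts (Star p) = {[Star p]} \<union> (\<lambda>K. K @ [Star p]) ` conts p"

lemma finite_conts: "finite (conts p)"
  by (induction p) auto

lemma conts_self: "[p] \<in> conts p"
  by (cases p) auto

lemma conts_nonempty: "K \<in> conts p \<Longrightarrow> K \<noteq> []"
  by (induction p arbitrary: K) auto

lemma expand_append: "K \<noteq> [] \<Longrightarrow> expand (K @ L) = (\<lambda>K'. K' @ L) ` expand K"
  by (induction K rule: expand.induct) auto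

definition closed_conts :: "'a prog list set \<Rightarrow> bool" where
  "closed_conts Q \<longleftrightarrow> (\<forall>K\<in>Q. expand K \<subseteq> Q \<and> (\<forall>a K'. K = Atom a # K' \<longrightarrow> K' \<in> Q))"

lemma expand_conts: "K \<in> conts p \<Longrightarrow> expand K \<subseteq> insert [] (conts p)"
proof (induction p arbitrary: K)
  case (Seq p q)
  then consider "K = [Seq p q]" | K' where "K = K' @ [q]" "K' \<in> conts p" | "K \<in> conts q"
    by auto
  then show ?case
  proof cases
    case 2
    then have "expand K = (\<lambda>L. L @ [q]) ` expand K'"
      using expand_append conts_nonempty by blast
    with 2 Seq.IH(1)[of K'] conts_self[of q] show ?thesis by auto
  next
    case 3
    with Seq.IH(2)[of K] show ?thesis by auto
  qed (use conts_self[of p] in auto)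
next
  case (Choice p q)
  then show ?case using conts_self[of p] conts_self[of q] by auto
next
  case (Star p)
  then consider "K = [Star p]" | K' where "K = K' @ [Star p]" "K' \<in> conts p"
    by auto
  then show ?case
  proof cases
    case 2
    then have "expand K = (\<lambda>L. L @ [Star p]) ` expand K'"
      using expand_append conts_nonempty by blast
    with 2 Star.IH(1)[of K'] show ?thesis by auto
  qed (use Star conts_self[of p] in auto)
qed auto

lemma tail_conts: "Atom a # K \<in> conts p \<Longrightarrow> K \<in> insert [] (conts p)"
proof (induction p arbitrary: K)
  case (Seq p q)
  then consider K' where "Atom a # K = K' @ [q]" "K' \<in> conts p" | "Atom a # K \<in> conts q"
    by auto
  then show ?case
  proof cases
    case 1
    then obtain L where "K' = Atom a # L" "K = L @ [q]"
      using conts_nonempty by (cases K') auto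
    with 1 Seq.IH(1)[of L] conts_self[of q] show ?thesis by auto
  qed (use Seq in auto)
next
  case (Star p)
  then obtain K' where K': "Atom a # K = K' @ [Star p]" "K' \<in> conts p"
    by auto
  then obtain L where "K' = Atom a # L" "K = L @ [Star p]"
    using conts_nonempty by (cases K') auto
  with K' Star.IH(1)[of L] show ?case by auto
qed auto

lemma closed_conts_conts: "closed_conts (insert [] (conts p))"
  using expand_conts tail_conts unfolding closed_conts_def by fastforce


section \<open>Compilation to a Turing machine\<close>

lemma atoms_conts: "K \<in> conts p \<Longrightarrow> q \<in> set K \<Longrightarrow> set_prog q \<subseteq> set_prog p"
  by (induction p arbitrary: K q) fastforce+

datatype action = Read input_symbol | GoLeft | GoRight | Assign nat nat | Test nat nat

instance input_symbol :: countable by countable_datatype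
instance action :: countable by countable_datatype

fun act_rel :: "bool list \<Rightarrow> action \<Rightarrow> (nat \<Rightarrow> nat) rel" where
  "act_rel x (Read a) = {(\<sigma>, \<sigma>) | \<sigma>. read_input x (\<sigma> 0) = a}"
| "act_rel x GoLeft = {(\<sigma>, \<sigma>(0 := \<sigma> 0 - 1)) | \<sigma>. 0 < \<sigma> 0}"
| "act_rel x GoRight = {(\<sigma>, \<sigma>(0 := Suc (\<sigma> 0))) | \<sigma>. \<sigma> 0 \<le> length x}"
| "act_rel x (Assign i j) = {(\<sigma>, \<sigma>(i := \<sigma> j)) | \<sigma>. True}"
| "act_rel x (Test i j) = {(\<sigma>, \<sigma>) | \<sigma>. \<sigma> i = \<sigma> j}"

lemma act_rel_unique: "(\<sigma>, \<sigma>') \<in> act_rel x b \<Longrightarrow> (\<sigma>, \<sigma>'') \<in> act_rel x b \<Longrightarrow> \<sigma>' = \<sigma>''"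
  by (cases b) auto

fun valid_action :: "nat \<Rightarrow> action \<Rightarrow> bool" where
  "valid_action m (Assign i j) \<longleftrightarrow> 0 < i \<and> i < m \<and> j < m"
| "valid_action m (Test i j) \<longleftrightarrow> i < m \<and> j < m"
| "valid_action m _ \<longleftrightarrow> True"

text \<open>Registers are the tracks of the tape, with the least significant bit in cell \<open>1\<close>.\<close>

datatype sym = Blank | Mark | Col "bool list"

datatype control =
    Init
  | Rest "action prog list"
  | Sweep bool "action prog list"
  | Back "action prog list"

instance sym :: countable by countable_datatype
instance control :: countable by countable_datatype

fun col_step :: "action \<Rightarrow> bool \<Rightarrow> bool list \<Rightarrow> bool \<times> bool list" where
  "col_step GoRight c bs = (c \<and> bs ! 0, bs[0 := (bs ! 0 \<noteq> c)])"
| "col_step GoLeft c bs = (c \<and> \<not> bs ! 0, bs[0 := (bs ! 0 \<noteq> c)])"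
| "col_step (Assign i j) c bs = (c, bs[i := bs ! j])"
| "col_step (Test i j) c bs = (c \<and> (bs ! i \<longleftrightarrow> bs ! j), bs)"
| "col_step (Read a) c bs = (c, bs)"

fun sweep :: "action \<Rightarrow> bool \<Rightarrow> bool list list \<Rightarrow> bool \<times> bool list list" where
  "sweep b c [] = (c, [])"
| "sweep b c (bs # cols) =
     (let (c1, bs1) = col_step b c bs; (c2, cols2) = sweep b c1 cols in (c2, bs1 # cols2))"

fun finish :: "nat \<Rightarrow> bool \<Rightarrow> action \<Rightarrow> sym set" where
  "finish m True GoRight = {Col (True # replicate (m - 1) False)}"
| "finish m False (Test i j) = {}"
| "finish m c b = {Blank}"

fun enabled :: "action \<Rightarrow> input_symbol \<Rightarrow> bool" where
  "enabled (Read b) a \<longleftrightarrow> a = b"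
| "enabled GoLeft a \<longleftrightarrow> a \<noteq> LeftEnd"
| "enabled GoRight a \<longleftrightarrow> a \<noteq> RightEnd"
| "enabled _ a \<longleftrightarrow> True"

fun head_move :: "action \<Rightarrow> dir" where
  "head_move GoLeft = MoveLeft"
| "head_move GoRight = MoveRight"
| "head_move _ = Stay"

fun delta ::
  "nat \<Rightarrow> action prog \<Rightarrow> control \<Rightarrow> input_symbol \<Rightarrow> sym \<Rightarrow> (control \<times> dir \<times> sym \<times> dir) set" where
  "delta m p Init a Blank = {(Rest [p], Stay, Mark, Stay)}"
| "delta m p (Rest (Atom b # K)) a Mark =
     (if enabled b a then {(Sweep True (Atom b # K), head_move b, Mark, MoveRight)} else {})"
| "delta m p (Rest K) a Mark = (\<lambda>K'. (Rest K', Stay, Mark, Stay)) ` expand K"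
| "delta m p (Sweep c (Atom b # K)) a (Col bs) =
     (let (c', bs') = col_step b c bs in {(Sweep c' (Atom b # K), Stay, Col bs', MoveRight)})"
| "delta m p (Sweep c (Atom b # K)) a Blank = (\<lambda>s. (Back K, Stay, s, MoveLeft)) ` finish m c b"
| "delta m p (Back K) a (Col bs) = {(Back K, Stay, Col bs, MoveLeft)}"
| "delta m p (Back K) a Mark = {(Rest K, Stay, Mark, Stay)}"
| "delta m p _ _ _ = {}"

definition controls :: "action prog \<Rightarrow> control set" where
  "controls p = (let Q = insert [] (conts p) in
     {Init} \<union> Rest ` Q \<union> (\<Union>c. Sweep c ` Q) \<union> Back ` Q)"

definition syms :: "nat \<Rightarrow> sym set" where
  "syms m = {Blank, Mark} \<union> Col ` {bs. length bs = m}"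

definition machine :: "nat \<Rightarrow> action prog \<Rightarrow> (nat, nat) tm" where
  "machine m p =
     \<lparr> num_tapes = 1, start = to_nat Init, accept = to_nat (Rest []), blank = to_nat Blank,
       trans = {((to_nat q, a, [to_nat s]), (to_nat q', d, [(to_nat w, e)])) | q a s q' d w e.
         q \<in> controls p \<and> s \<in> syms m \<and> (q', d, w, e) \<in> delta m p q a s} \<rparr>"

lemma finite_input_symbol: "finite (UNIV :: input_symbol set)"
proof -
  have "(UNIV :: input_symbol set) = {LeftEnd, Letter True, Letter False, RightEnd}"
    by (auto intro: input_symbol.exhaust)
  then show ?thesis by (metis finite.emptyI finite_insert)
qed

lemma finite_expand: "finite (expand K)"
  by (induction K rule: expand.induct) auto

lemma finite_delta: "finite (delta m p q a s)"
proof -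
  have "finite (finish m c b)" for c b
    by (induction m c b rule: finish.induct) auto
  then show ?thesis
    by (induction m p q a s rule: delta.induct) (auto simp: finite_expand split: prod.split)
qed

lemma turing_machine_machine: "turing_machine (machine m p)"
proof -
  have "finite (controls p)"
    by (auto simp: controls_def Let_def finite_conts)
  moreover have "finite (syms m)"
    using finite_lists_length_eq[of "UNIV :: bool set" m] by (simp add: syms_def)
  ultimately have "finite (\<Union>q\<in>controls p. \<Union>a. \<Union>s\<in>syms m.
    (\<lambda>(q', d, w, e). ((to_nat q, a, [to_nat s]), (to_nat q', d, [(to_nat w, e)]))) ` delta m p q a s)"
    using finite_input_symbol finite_delta by (intro finite_UN_I finite_imageI) auto
  moreover have "trans (machine m p) \<subseteq> (\<Union>q\<in>controls p. \<Union>a. \<Union>s\<in>syms m.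
    (\<lambda>(q', d, w, e). ((to_nat q, a, [to_nat s]), (to_nat q', d, [(to_nat w, e)]))) ` delta m p q a s)"
    by (force simp: machine_def)
  ultimately have "finite (trans (machine m p))"
    by (rule finite_subset[rotated])
  then show ?thesis
    by (auto simp: turing_machine_def machine_def)
qed

definition conf :: "control \<Rightarrow> nat \<Rightarrow> (nat \<Rightarrow> sym) \<Rightarrow> nat \<Rightarrow> (nat, nat) config" where
  "conf q i f h = \<lparr> state = to_nat q, input_head = i, work = [(to_nat \<circ> f, h)] \<rparr>"

lemma syms_simps [simp]: "Blank \<in> syms m" "Mark \<in> syms m" "Col bs \<in> syms m \<longleftrightarrow> length bs = m"
  by (auto simp: syms_def)

lemma conf_steps:
  assumes "q \<in> controls p" "f h \<in> syms m"
  shows "(conf q i f h, C) \<in> steps (machine m p) x \<longleftrightarrow>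
    (\<exists>q' d w e. (q', d, w, e) \<in> delta m p q (read_input x i) (f h) \<and>
       C = conf q' (min (move d i) (Suc (length x))) (f(h := w)) (move e h))" (is "?L \<longleftrightarrow> ?R")
proof
  assume ?L
  then obtain q' d w e where "(q', d, w, e) \<in> delta m p q (read_input x i) (f h)"
    and C: "state C = to_nat q'" "input_head C = min (move d i) (Suc (length x))"
      "work C = [((to_nat \<circ> f)(h := to_nat w), move e h)]"
    by (auto simp: steps_def machine_def conf_def)
  moreover have "C = conf q' (min (move d i) (Suc (length x))) (f(h := w)) (move e h)"
    using C by (cases C) (auto simp: conf_def fun_upd_comp)
  ultimately show ?R by blast
next
  assume ?R
  then show ?L using assms
    by (force simp: steps_def machine_def conf_def fun_upd_comp)
qed

definition tape :: "bool list list \<Rightarrow> nat \<Rightarrow> sym" where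
  "tape cols n = (if n = 0 then Mark else if n \<le> length cols then Col (cols ! (n - 1)) else Blank)"

lemma tape_0 [simp]: "tape cols 0 = Mark"
  by (simp add: tape_def)

lemma tape_Mark [simp]: "(tape cols)(0 := Mark) = tape cols"
  by (auto simp: tape_def)

lemma tape_mid [simp]: "tape (cols @ bs # cols') (Suc (length cols)) = Col bs"
  by (simp add: tape_def)

lemma tape_mid_update: "(tape (cols @ bs # cols'))(Suc (length cols) := Col bs') = tape (cols @ bs' # cols')"
  by (auto simp: tape_def fun_eq_iff nth_append nth_Cons')

lemma tape_end [simp]: "tape cols (Suc (length cols)) = Blank"
  by (simp add: tape_def)

lemma tape_Blank [simp]: "(tape cols)(Suc (length cols) := Blank) = tape cols"
  by (auto simp: tape_def)

lemma tape_extend: "(tape cols)(Suc (length cols) := Col bs) = tape (cols @ [bs])"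
  by (auto simp: tape_def fun_eq_iff nth_append)

fun val :: "bool list list \<Rightarrow> nat \<Rightarrow> nat" where
  "val [] i = 0"
| "val (bs # cols) i = of_bool (bs ! i) + 2 * val cols i"

lemma val_append: "val (cols @ [bs]) i = val cols i + 2 ^ length cols * of_bool (bs ! i)"
  by (induction cols) auto

lemma val_less: "val cols i < 2 ^ length cols"
proof (induction cols)
  case (Cons bs cols)
  then show ?case by (cases "bs ! i") auto
qed simp

abbreviation columns :: "nat \<Rightarrow> bool list list \<Rightarrow> bool" where
  "columns m cols \<equiv> \<forall>bs\<in>set cols. length bs = m"

lemma length_col_step: "length (snd (col_step b c bs)) = length bs"
  by (cases b) auto

lemma sweep_columns:
  "columns m cols \<Longrightarrow> sweep b c cols = (c', cols') \<Longrightarrow> columns m cols' \<and> length cols' = length cols"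
proof (induction cols arbitrary: c cols')
  case (Cons bs cols)
  then show ?case using length_col_step[of b c bs] by (auto simp: Let_def split: prod.splits)
qed simp

lemma sweep_GoRight:
  assumes "columns m cols" "0 < m" "sweep GoRight c cols = (c', cols')"
  shows "val cols' 0 + of_bool c' * 2 ^ length cols = val cols 0 + of_bool c \<and>
    (\<forall>i. 0 < i \<longrightarrow> i < m \<longrightarrow> val cols' i = val cols i)"
  using assms
proof (induction cols arbitrary: c cols')
  case (Cons bs cols)
  obtain cols2 where 2: "sweep GoRight (c \<and> bs ! 0) cols = (c', cols2)" "cols' = bs[0 := (bs ! 0 \<noteq> c)] # cols2"
    using Cons.prems by (auto simp: Let_def split: prod.splits)
  from Cons.IH[OF _ _ 2(1)] Cons.prems(1,2) have
    IH: "val cols2 0 + of_bool c' * 2 ^ length cols = val cols 0 + of_bool (c \<and> bs ! 0)"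
    "\<forall>i. 0 < i \<longrightarrow> i < m \<longrightarrow> val cols2 i = val cols i" by auto
  have "0 < length bs" using Cons.prems by auto
  with IH 2(2) show ?case by (cases c; cases "bs ! 0"; cases c') (auto simp: nth_list_update)
qed simp

lemma sweep_GoLeft:
  assumes "columns m cols" "0 < m" "sweep GoLeft c cols = (c', cols')"
  shows "val cols' 0 + of_bool c = val cols 0 + of_bool c' * 2 ^ length cols \<and>
    (\<forall>i. 0 < i \<longrightarrow> i < m \<longrightarrow> val cols' i = val cols i)"
  using assms
proof (induction cols arbitrary: c cols')
  case (Cons bs cols)
  obtain cols2 where 2: "sweep GoLeft (c \<and> \<not> bs ! 0) cols = (c', cols2)" "cols' = bs[0 := (bs ! 0 \<noteq> c)] # cols2"
    using Cons.prems by (auto simp: Let_def split: prod.splits)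
  from Cons.IH[OF _ _ 2(1)] Cons.prems(1,2) have
    IH: "val cols2 0 + of_bool (c \<and> \<not> bs ! 0) = val cols 0 + of_bool c' * 2 ^ length cols"
    "\<forall>i. 0 < i \<longrightarrow> i < m \<longrightarrow> val cols2 i = val cols i" by auto
  have "0 < length bs" using Cons.prems by auto
  with IH 2(2) show ?case by (cases c; cases "bs ! 0"; cases c') (auto simp: nth_list_update)
qed simp

lemma sweep_Assign:
  assumes "columns m cols" "i < m" "sweep (Assign i j) c cols = (c', cols')"
  shows "c' = c \<and> (\<forall>l. val cols' l = (if l = i then val cols j else val cols l))"
  using assms
proof (induction cols arbitrary: c cols')
  case (Cons bs cols)
  then show ?case by (auto simp: Let_def nth_list_update split: prod.splits)
qed simp

lemma sweep_Test:
  "sweep (Test i j) c cols = (c', cols') \<Longrightarrow> cols' = cols \<and> (c' \<longleftrightarrow> c \<and> val cols i = val cols j)"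
proof (induction cols arbitrary: c cols')
  case (Cons bs cols)
  obtain cols2 where 2: "sweep (Test i j) (c \<and> (bs ! i \<longleftrightarrow> bs ! j)) cols = (c', cols2)" "cols' = bs # cols2"
    using Cons.prems by (auto simp: Let_def split: prod.splits)
  have "(of_bool a + 2 * v = of_bool b + 2 * w) \<longleftrightarrow> (a \<longleftrightarrow> b) \<and> v = w" for a b and v w :: nat
    by (cases a; cases b; simp; presburger)
  with Cons.IH[OF 2(1)] 2(2) show ?case by auto
qed simp

lemma sweep_Read: "sweep (Read a) c cols = (c, cols)"
  by (induction cols) auto

text \<open>Register \<open>0\<close> mirrors the position of the input head.\<close>

definition represents :: "nat \<Rightarrow> bool list \<Rightarrow> bool list list \<Rightarrow> (nat \<Rightarrow> nat) \<Rightarrow> bool" where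
  "represents m x cols \<sigma> \<longleftrightarrow> columns m cols \<and> (\<forall>i<m. val cols i = \<sigma> i) \<and> \<sigma> 0 \<le> Suc (length x) \<and>
     2 ^ (length cols - 1) \<le> Suc (length x)"

locale sweeping =
  fixes m :: nat and p :: "action prog" and x :: "bool list" and S :: nat
  assumes m_pos: "0 < m"
    and valid: "\<And>b. b \<in> set_prog p \<Longrightarrow> valid_action m b"
    and S: "\<And>l. 2 ^ l \<le> Suc (length x) \<Longrightarrow> l + 3 < S"
begin

abbreviation "M \<equiv> machine m p"

abbreviation "Q \<equiv> insert [] (conts p)"

definition space_ok :: "(nat, nat) config \<Rightarrow> bool" where
  "space_ok c \<longleftrightarrow> (\<forall>(f, h)\<in>set (work c). h < S)"

text \<open>
  Between two rest configurations the machine is deterministic, so once the run of an atomic action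
  is known to end in some configuration, every run passes through it.
\<close>

definition det :: "(nat, nat) config rel" where
  "det = {(c, c'). steps M x `` {c} = {c'} \<and> space_ok c}"

definition dead :: "(nat, nat) config \<Rightarrow> bool" where
  "dead c \<longleftrightarrow> steps M x `` {c} = {} \<and> space_ok c \<and> state c \<noteq> accept M"

lemma space_ok_conf [simp]: "space_ok (conf q i f h) \<longleftrightarrow> h < S"
  by (simp add: space_ok_def conf_def)

lemma image_conf:
  assumes "q \<in> controls p" "f h \<in> syms m"
  shows "steps M x `` {conf q i f h} =
    (\<lambda>(q', d, w, e). conf q' (min (move d i) (Suc (length x))) (f(h := w)) (move e h)) `
      delta m p q (read_input x i) (f h)"
  using conf_steps[of q p f h m i _ x] assms by (force simp: image_iff)

lemma controls_Q: "K \<in> Q \<Longrightarrow> Rest K \<in> controls p" "K \<in> Q \<Longrightarrow> Sweep c K \<in> controls p"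
  "K \<in> Q \<Longrightarrow> Back K \<in> controls p"
  by (auto simp: controls_def Let_def)

lemma tape_syms: "columns m cols \<Longrightarrow> tape cols h \<in> syms m"
  by (auto simp: tape_def syms_def)

lemma sweep_chain:
  assumes "Atom b # K \<in> Q" "columns m (cols @ todo)" "length (cols @ todo) + 2 \<le> S"
    "i \<le> Suc (length x)" "sweep b c todo = (c', todo')"
  shows "(conf (Sweep c (Atom b # K)) i (tape (cols @ todo)) (Suc (length cols)),
    conf (Sweep c' (Atom b # K)) i (tape (cols @ todo')) (Suc (length (cols @ todo)))) \<in> det\<^sup>*"
  using assms
proof (induction todo arbitrary: cols c todo')
  case (Cons bs todo)
  obtain c1 bs1 where 1: "col_step b c bs = (c1, bs1)" by fastforce
  with Cons.prems obtain todo1 where 2: "sweep b c1 todo = (c', todo1)" "todo' = bs1 # todo1"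
    by (auto split: prod.splits)
  have "(conf (Sweep c (Atom b # K)) i (tape (cols @ bs # todo)) (Suc (length cols)),
     conf (Sweep c1 (Atom b # K)) i (tape ((cols @ [bs1]) @ todo)) (Suc (length (cols @ [bs1])))) \<in> det"
    using Cons.prems controls_Q(2)[OF Cons.prems(1), of c] tape_syms[OF Cons.prems(2)]
    by (simp add: det_def image_conf 1 tape_mid_update min_def del: fun_upd_apply)
  moreover have "(conf (Sweep c1 (Atom b # K)) i (tape ((cols @ [bs1]) @ todo)) (Suc (length (cols @ [bs1]))),
     conf (Sweep c' (Atom b # K)) i (tape ((cols @ [bs1]) @ todo1)) (Suc (length ((cols @ [bs1]) @ todo)))) \<in> det\<^sup>*"
    using Cons.prems length_col_step[of b c bs] 1 2 by (intro Cons.IH) auto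
  ultimately show ?case using 2 by (auto intro: converse_rtrancl_into_rtrancl)
qed simp

lemma back_chain:
  assumes "K \<in> Q" "columns m cols" "h \<le> length cols" "length cols < S" "i \<le> Suc (length x)"
  shows "(conf (Back K) i (tape cols) h, conf (Rest K) i (tape cols) 0) \<in> det\<^sup>*"
  using assms
proof (induction h)
  case 0
  then have "(conf (Back K) i (tape cols) 0, conf (Rest K) i (tape cols) 0) \<in> det"
    using controls_Q(3)[OF 0(1)] tape_syms[OF 0(2)]
    by (simp add: det_def image_conf min_def del: fun_upd_apply)
  then show ?case by auto
next
  case (Suc h)
  have "tape cols (Suc h) = Col (cols ! h)" using Suc.prems by (simp add: tape_def)
  moreover from this have "(tape cols)(Suc h := Col (cols ! h)) = tape cols" by auto
  ultimately have "(conf (Back K) i (tape cols) (Suc h), conf (Back K) i (tape cols) h) \<in> det"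
    using controls_Q(3)[OF Suc.prems(1)] tape_syms[OF Suc.prems(2), of "Suc h"] Suc.prems
    by (simp add: det_def image_conf min_def del: fun_upd_apply)
  with Suc show ?case by (auto intro: converse_rtrancl_into_rtrancl)
qed

lemma represents_space: "represents m x cols \<sigma> \<Longrightarrow> length cols + 2 < S"
  using S[of "length cols - 1"] by (simp add: represents_def)

lemma read_input_LeftEnd: "read_input x i = LeftEnd \<longleftrightarrow> i = 0"
  by (simp add: read_input_def)

lemma read_input_RightEnd: "read_input x i = RightEnd \<longleftrightarrow> length x < i"
  by (auto simp: read_input_def)

lemma enabled_act_rel: "(\<sigma>, \<sigma>') \<in> act_rel x b \<Longrightarrow> enabled b (read_input x (\<sigma> 0))"
  by (cases b) (auto simp: read_input_LeftEnd read_input_RightEnd)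

lemma finish_cases:
  assumes rep: "represents m x cols \<sigma>" and b: "valid_action m b" and en: "enabled b (read_input x (\<sigma> 0))"
    and sw: "sweep b True cols = (c', cols')"
  shows "(\<exists>i j. finish m c' b = {} \<and> b = Test i j \<and> \<sigma> i \<noteq> \<sigma> j) \<or>
    (\<exists>s cols'' \<sigma>'. finish m c' b = {s} \<and> (\<sigma>, \<sigma>') \<in> act_rel x b \<and> represents m x cols'' \<sigma>' \<and>
      (tape cols')(Suc (length cols) := s) = tape cols'' \<and> length cols \<le> length cols'' \<and>
      min (move (head_move b) (\<sigma> 0)) (Suc (length x)) = \<sigma>' 0)"
proof -
  have cols: "columns m cols" "\<And>i. i < m \<Longrightarrow> val cols i = \<sigma> i" "\<sigma> 0 \<le> Suc (length x)"
    "2 ^ (length cols - 1) \<le> Suc (length x)"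
    using rep by (auto simp: represents_def)
  have cols': "columns m cols'" and len: "length cols' = length cols"
    using sweep_columns[OF cols(1) sw] by auto
  have end_eq: "(tape cols')(Suc (length cols) := Blank) = tape cols'"
    using tape_Blank[of cols'] len by simp
  have success: ?thesis if "finish m c' b = {s}" "(\<sigma>, \<sigma>') \<in> act_rel x b" "represents m x cols'' \<sigma>'"
    "(tape cols')(Suc (length cols) := s) = tape cols''" "length cols \<le> length cols''"
    "min (move (head_move b) (\<sigma> 0)) (Suc (length x)) = \<sigma>' 0" for s cols'' \<sigma>'
    using that by blast
  show ?thesis
  proof (cases b)
    case (Read a)
    then have "c' = True" "cols' = cols" using sw by (auto simp: sweep_Read)
    then show ?thesis using Read rep en cols(3) end_eq
      by (intro success[of Blank \<sigma> cols]) (simp_all add: min_def)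
  next
    case GoLeft
    have pos: "0 < \<sigma> 0" using en GoLeft by (simp add: read_input_def split: if_splits)
    have v: "val cols' 0 + 1 = val cols 0 + of_bool c' * 2 ^ length cols"
      "\<And>i. 0 < i \<Longrightarrow> i < m \<Longrightarrow> val cols' i = val cols i"
      using sweep_GoLeft[OF cols(1) m_pos sw[unfolded GoLeft]] by auto
    have "\<not> c'" using v(1) val_less[of cols' 0] len pos cols(2)[OF m_pos] by (cases c') auto
    then have "val cols' i = (\<sigma>(0 := \<sigma> 0 - 1)) i" if "i < m" for i
      using v cols(2) that by (cases "i = 0") auto
    then have "represents m x cols' (\<sigma>(0 := \<sigma> 0 - 1))"
      using cols' len cols by (simp add: represents_def)
    then show ?thesis using GoLeft pos cols(3) end_eq len
      by (intro success[of Blank "\<sigma>(0 := \<sigma> 0 - 1)" cols']) (simp_all add: min_def)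
  next
    case GoRight
    have le: "\<sigma> 0 \<le> length x" using en GoRight by (simp add: read_input_def split: if_splits)
    have v: "val cols' 0 + of_bool c' * 2 ^ length cols = val cols 0 + 1"
      "\<And>i. 0 < i \<Longrightarrow> i < m \<Longrightarrow> val cols' i = val cols i"
      using sweep_GoRight[OF cols(1) m_pos sw[unfolded GoRight]] by auto
    show ?thesis
    proof (cases c')
      case True
      let ?cols = "cols' @ [True # replicate (m - 1) False]"
      have "val ?cols i = (\<sigma>(0 := Suc (\<sigma> 0))) i" if "i < m" for i
      proof (cases i)
        case 0
        then show ?thesis using v(1) True len cols(2)[OF m_pos] by (simp add: val_append)
      next
        case (Suc l)
        then show ?thesis using v(2)[of i] cols(2)[of i] that len by (simp add: val_append)
      qed
      moreover have "2 ^ length cols \<le> Suc (length x)"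
        using v(1) True cols(2)[OF m_pos] le by simp
      ultimately have "represents m x ?cols (\<sigma>(0 := Suc (\<sigma> 0)))"
        using cols' len le m_pos by (simp add: represents_def)
      moreover have "(tape cols')(Suc (length cols) := Col (True # replicate (m - 1) False)) = tape ?cols"
        using tape_extend[of cols'] len by simp
      ultimately show ?thesis using GoRight True le len
        by (intro success[of _ "\<sigma>(0 := Suc (\<sigma> 0))" ?cols]) (simp_all add: min_def)
    next
      case False
      then have "val cols' i = (\<sigma>(0 := Suc (\<sigma> 0))) i" if "i < m" for i
        using v cols(2) that by (cases "i = 0") auto
      then have "represents m x cols' (\<sigma>(0 := Suc (\<sigma> 0)))"
        using cols' len cols(4) le by (simp add: represents_def)
      then show ?thesis using GoRight False le end_eq len
        by (intro success[of Blank "\<sigma>(0 := Suc (\<sigma> 0))" cols']) (simp_all add: min_def)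
    qed
  next
    case (Assign i j)
    then have ij: "0 < i" "i < m" "j < m" using b by auto
    have v: "c'" "\<And>l. val cols' l = (if l = i then val cols j else val cols l)"
      using sweep_Assign[OF cols(1) ij(2) sw[unfolded Assign]] by auto
    then have "represents m x cols' (\<sigma>(i := \<sigma> j))"
      using cols' len cols ij by (simp add: represents_def)
    then show ?thesis using Assign v(1) ij cols(3) end_eq len
      by (intro success[of Blank "\<sigma>(i := \<sigma> j)" cols']) (simp_all add: min_def)
  next
    case (Test i j)
    have v: "cols' = cols" "c' \<longleftrightarrow> \<sigma> i = \<sigma> j"
      using sweep_Test[OF sw[unfolded Test]] b[unfolded Test] cols(2) by auto
    show ?thesis
    proof (cases c')
      case True
      then show ?thesis using Test v rep cols(3) end_eq
        by (intro success[of Blank \<sigma> cols]) (simp_all add: min_def)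
    next
      case False
      then show ?thesis using Test v by simp
    qed
  qed
qed

definition rest :: "action prog list \<Rightarrow> (nat \<Rightarrow> nat) \<Rightarrow> (nat, nat) config \<Rightarrow> bool" where
  "rest K \<sigma> C \<longleftrightarrow> (\<exists>cols. represents m x cols \<sigma> \<and> C = conf (Rest K) (\<sigma> 0) (tape cols) 0)"

lemma atom_chain:
  assumes rep: "represents m x cols \<sigma>" and K: "Atom b # K \<in> Q" and b: "valid_action m b"
    and en: "enabled b (read_input x (\<sigma> 0))"
  defines "C \<equiv> conf (Sweep True (Atom b # K)) (min (move (head_move b) (\<sigma> 0)) (Suc (length x))) (tape cols) 1"
  shows "\<exists>C'. (C, C') \<in> det\<^sup>* \<and>
    (dead C' \<and> (\<nexists>\<sigma>'. (\<sigma>, \<sigma>') \<in> act_rel x b) \<or> (\<exists>\<sigma>'. (\<sigma>, \<sigma>') \<in> act_rel x b \<and> rest K \<sigma>' C'))"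
proof -
  let ?i = "min (move (head_move b) (\<sigma> 0)) (Suc (length x))"
  obtain c' cols' where sw: "sweep b True cols = (c', cols')" by fastforce
  have cols: "columns m cols" using rep by (simp add: represents_def)
  have cols': "columns m cols'" and len: "length cols' = length cols"
    using sweep_columns[OF cols sw] by auto
  have K': "K \<in> Q" using K closed_conts_conts[of p] by (auto simp: closed_conts_def)
  let ?D = "conf (Sweep c' (Atom b # K)) ?i (tape cols') (Suc (length cols))"
  have chain: "(C, ?D) \<in> det\<^sup>*"
    using sweep_chain[of b K "[]" cols ?i True c' cols'] K cols represents_space[OF rep] sw
    by (simp add: C_def)
  have D: "steps M x `` {?D} =
    (\<lambda>s. conf (Back K) ?i ((tape cols')(Suc (length cols) := s)) (length cols)) ` finish m c' b"
    using controls_Q(2)[OF K, of c'] tape_syms[OF cols', of "Suc (length cols)"] tape_end[of cols'] len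
    by (simp add: image_conf image_image del: fun_upd_apply)
  have D_space: "space_ok ?D" using represents_space[OF rep] by simp
  from finish_cases[OF rep b en sw] show ?thesis
  proof (elim disjE exE conjE)
    fix i j assume f: "finish m c' b = {}" "b = Test i j" "\<sigma> i \<noteq> \<sigma> j"
    have "state ?D \<noteq> accept M" by (simp add: conf_def machine_def)
    with f D D_space have "dead ?D" by (simp add: dead_def)
    with f chain show ?thesis by auto
  next
    fix s cols'' \<sigma>'
    assume f: "finish m c' b = {s}" "(\<sigma>, \<sigma>') \<in> act_rel x b" "represents m x cols'' \<sigma>'"
      "(tape cols')(Suc (length cols) := s) = tape cols''" "length cols \<le> length cols''"
      "?i = \<sigma>' 0"
    then have "(?D, conf (Back K) (\<sigma>' 0) (tape cols'') (length cols)) \<in> det"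
      using D D_space by (simp add: det_def)
    moreover have "(conf (Back K) (\<sigma>' 0) (tape cols'') (length cols),
        conf (Rest K) (\<sigma>' 0) (tape cols'') 0) \<in> det\<^sup>*"
      using K' f represents_space[OF f(3)] by (intro back_chain) (auto simp: represents_def)
    moreover have "rest K \<sigma>' (conf (Rest K) (\<sigma>' 0) (tape cols'') 0)"
      using f(3) by (auto simp: rest_def)
    ultimately show ?thesis using chain f(2)
      by (meson converse_rtrancl_into_rtrancl rtrancl_trans)
  qed
qed

abbreviation "astep \<equiv> prog_step (act_rel x)"

definition good :: "(nat, nat) config \<Rightarrow> bool" where
  "good C \<longleftrightarrow> (\<exists>C'. (C, C') \<in> det\<^sup>* \<and> (dead C' \<or>
     (\<exists>K \<sigma>. K \<in> Q \<and> (([p], \<lambda>_. 0), (K, \<sigma>)) \<in> astep\<^sup>* \<and> rest K \<sigma> C')))"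

lemma rest_successors:
  assumes "represents m x cols \<sigma>" "K \<in> Q"
  shows "steps M x `` {conf (Rest K) (\<sigma> 0) (tape cols) 0} =
    (case K of Atom b # K' \<Rightarrow> if enabled b (read_input x (\<sigma> 0)) then
        {conf (Sweep True K) (min (move (head_move b) (\<sigma> 0)) (Suc (length x))) (tape cols) 1} else {}
      | _ \<Rightarrow> (\<lambda>K'. conf (Rest K') (\<sigma> 0) (tape cols) 0) ` expand K)"
proof -
  have "columns m cols" and min: "min (\<sigma> 0) (Suc (length x)) = \<sigma> 0"
    using assms(1) by (auto simp: represents_def)
  then have 1: "steps M x `` {conf (Rest K) (\<sigma> 0) (tape cols) 0} =
    (\<lambda>(q', d, w, e). conf q' (min (move d (\<sigma> 0)) (Suc (length x))) ((tape cols)(0 := w)) (move e 0)) `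
      delta m p (Rest K) (read_input x (\<sigma> 0)) Mark"
    using image_conf[OF controls_Q(1)[OF assms(2)], of "tape cols" 0 "\<sigma> 0"] tape_syms by simp
  show ?thesis
  proof (cases K)
    case Nil
    then show ?thesis using 1 by simp
  next
    case (Cons q L)
    then show ?thesis using 1 min by (cases q) (auto simp del: fun_upd_apply)
  qed
qed

lemma valid_conts: "Atom b # K \<in> Q \<Longrightarrow> valid_action m b"
  using atoms_conts[of "Atom b # K" p "Atom b"] valid by auto

lemma rest_step_sound:
  assumes "rest K \<sigma> C" "K \<in> Q" "(([p], \<lambda>_. 0), (K, \<sigma>)) \<in> astep\<^sup>*" "(C, C1) \<in> steps M x"
  shows "good C1"
proof -
  obtain cols where rep: "represents m x cols \<sigma>" and C: "C = conf (Rest K) (\<sigma> 0) (tape cols) 0"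
    using assms(1) by (auto simp: rest_def)
  have C1: "C1 \<in> steps M x `` {conf (Rest K) (\<sigma> 0) (tape cols) 0}"
    using assms(4) C by auto
  show ?thesis
  proof (cases "\<exists>b K'. K = Atom b # K'")
    case True
    then obtain b K' where K: "K = Atom b # K'" by auto
    with C1 have en: "enabled b (read_input x (\<sigma> 0))"
      and C1_eq: "C1 = conf (Sweep True (Atom b # K')) (min (move (head_move b) (\<sigma> 0)) (Suc (length x))) (tape cols) 1"
      unfolding rest_successors[OF rep assms(2)] by (auto split: if_splits)
    have K'_Q: "K' \<in> Q" using K assms(2) closed_conts_conts[of p] by (auto simp: closed_conts_def)
    have "(([p], \<lambda>_. 0), (K', \<sigma>')) \<in> astep\<^sup>*" if "(\<sigma>, \<sigma>') \<in> act_rel x b" for \<sigma>'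
      using assms(3) that K by (auto simp: prog_step_def intro: rtrancl_into_rtrancl)
    with atom_chain[OF rep assms(2)[unfolded K] valid_conts[OF assms(2)[unfolded K]] en] K'_Q
    show ?thesis unfolding good_def C1_eq by blast
  next
    case False
    with C1 obtain K' where K': "K' \<in> expand K" "C1 = conf (Rest K') (\<sigma> 0) (tape cols) 0"
      unfolding rest_successors[OF rep assms(2)] by (auto split: list.splits prog.splits)
    have "K' \<in> Q" using K' assms(2) closed_conts_conts[of p] by (auto simp: closed_conts_def)
    moreover have "(([p], \<lambda>_. 0), (K', \<sigma>)) \<in> astep\<^sup>*"
      using assms(3) K' by (auto simp: prog_step_def intro: rtrancl_into_rtrancl)
    moreover have "rest K' \<sigma> C1" using K' rep by (auto simp: rest_def)
    ultimately show ?thesis unfolding good_def by blast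
  qed
qed

lemma good_step:
  assumes "good C" "(C, C1) \<in> steps M x"
  shows "good C1"
proof -
  obtain C' where chain: "(C, C') \<in> det\<^sup>*"
    and C': "dead C' \<or> (\<exists>K \<sigma>. K \<in> Q \<and> (([p], \<lambda>_. 0), (K, \<sigma>)) \<in> astep\<^sup>* \<and> rest K \<sigma> C')"
    using assms(1) by (auto simp: good_def)
  from chain show ?thesis
  proof (cases rule: converse_rtranclE)
    case base
    then show ?thesis using C' assms(2) rest_step_sound by (auto simp: dead_def)
  next
    case (step y)
    then have "y = C1" using assms(2) by (auto simp: det_def)
    with step C' show ?thesis by (auto simp: good_def)
  qed
qed

lemma initial_conf: "initial M = conf Init 0 (\<lambda>_. Blank) 0"
  by (simp add: initial_def machine_def conf_def comp_def)

lemma initial_det: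
  obtains C where "(initial M, C) \<in> det" "rest [p] (\<lambda>_. 0) C"
proof
  have "(\<lambda>_. Blank)(0 := Mark) = tape []" by (auto simp: tape_def)
  then show "(initial M, conf (Rest [p]) 0 (tape []) 0) \<in> det"
    using S[of 0] by (simp add: initial_conf det_def image_conf controls_def Let_def syms_def)
  show "rest [p] (\<lambda>_. 0) (conf (Rest [p]) 0 (tape []) 0)"
    unfolding rest_def by (rule exI[of _ "[]"]) (simp add: represents_def)
qed

lemma good_reachable: "(initial M, C) \<in> (steps M x)\<^sup>* \<Longrightarrow> good C"
proof (induction rule: rtrancl_induct)
  case base
  obtain C where "(initial M, C) \<in> det" "rest [p] (\<lambda>_. 0) C" by (rule initial_det)
  then show ?case unfolding good_def using conts_self by blast
next
  case (step y z)
  then show ?case using good_step by blast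
qed

lemma good_space: "good C \<Longrightarrow> space_ok C"
proof -
  assume "good C"
  then obtain C' where chain: "(C, C') \<in> det\<^sup>*" and "dead C' \<or> (\<exists>K \<sigma>. rest K \<sigma> C')"
    by (auto simp: good_def)
  then have "space_ok C'" using S[of 0] by (auto simp: dead_def rest_def)
  with chain show ?thesis by (cases rule: converse_rtranclE) (auto simp: det_def)
qed

lemma uses_space: "uses_space M x S"
  unfolding uses_space_def using good_reachable good_space[unfolded space_ok_def] by blast

lemma det_steps: "det\<^sup>* \<subseteq> (steps M x)\<^sup>*"
  by (rule rtrancl_mono) (auto simp: det_def)

lemma rest_step_complete:
  assumes "rest K \<sigma> C" "K \<in> Q" "((K, \<sigma>), (K', \<sigma>')) \<in> astep"
  shows "K' \<in> Q \<and> (\<exists>C'. (C, C') \<in> (steps M x)\<^sup>* \<and> rest K' \<sigma>' C')"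
proof -
  obtain cols where rep: "represents m x cols \<sigma>" and C: "C = conf (Rest K) (\<sigma> 0) (tape cols) 0"
    using assms(1) by (auto simp: rest_def)
  from assms(3) consider b where "K = Atom b # K'" "(\<sigma>, \<sigma>') \<in> act_rel x b" | "K' \<in> expand K" "\<sigma>' = \<sigma>"
    by (auto simp: prog_step_def)
  then show ?thesis
  proof cases
    case 1
    let ?C = "conf (Sweep True (Atom b # K')) (min (move (head_move b) (\<sigma> 0)) (Suc (length x))) (tape cols) 1"
    have en: "enabled b (read_input x (\<sigma> 0))" using 1 enabled_act_rel by blast
    then have "(C, ?C) \<in> steps M x"
      using rest_successors[OF rep assms(2)] 1 C by (auto split: if_splits)
    moreover obtain C' where "(?C, C') \<in> det\<^sup>*" "rest K' \<sigma>' C'"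
      using atom_chain[OF rep assms(2)[unfolded 1] valid_conts[OF assms(2)[unfolded 1]] en] 1
        act_rel_unique by blast
    moreover have "K' \<in> Q" using 1 assms(2) closed_conts_conts[of p] by (auto simp: closed_conts_def)
    ultimately show ?thesis using det_steps by (meson converse_rtrancl_into_rtrancl subsetD)
  next
    case 2
    then have "conf (Rest K') (\<sigma> 0) (tape cols) 0 \<in> steps M x `` {C}"
      using rest_successors[OF rep assms(2)] C by (cases K rule: expand.cases) auto
    moreover have "rest K' \<sigma>' (conf (Rest K') (\<sigma> 0) (tape cols) 0)"
      using rep 2 by (auto simp: rest_def)
    moreover have "K' \<in> Q" using 2 assms(2) closed_conts_conts[of p] by (auto simp: closed_conts_def)
    ultimately show ?thesis by blast
  qed
qed

lemma rest_steps_complete: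
  assumes "((K, \<sigma>), (K', \<sigma>')) \<in> astep\<^sup>*" "rest K \<sigma> C" "K \<in> Q"
  shows "K' \<in> Q \<and> (\<exists>C'. (C, C') \<in> (steps M x)\<^sup>* \<and> rest K' \<sigma>' C')"
  using assms
proof (induction "(K', \<sigma>')" arbitrary: K' \<sigma>' rule: rtrancl_induct)
  case base
  then show ?case by blast
next
  case (step y)
  obtain K1 \<sigma>1 where y: "y = (K1, \<sigma>1)" by fastforce
  obtain C1 where C1: "K1 \<in> Q" "(C, C1) \<in> (steps M x)\<^sup>*" "rest K1 \<sigma>1 C1"
    using step.hyps(3)[OF y step.prems] by blast
  obtain C2 where "K' \<in> Q" "(C1, C2) \<in> (steps M x)\<^sup>*" "rest K' \<sigma>' C2"
    using rest_step_complete[OF C1(3,1) step.hyps(2)[unfolded y]] by blast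
  with C1(2) show ?case by (meson rtrancl_trans)
qed

lemma accepts_iff: "accepts M x \<longleftrightarrow> (\<exists>\<sigma>. (\<lambda>_. 0, \<sigma>) \<in> sem (act_rel x) p)"
proof
  assume "accepts M x"
  then obtain C where C: "(initial M, C) \<in> (steps M x)\<^sup>*" "halted M x C" "state C = accept M"
    by (auto simp: accepts_def)
  then obtain C' where chain: "(C, C') \<in> det\<^sup>*" and C': "dead C' \<or>
     (\<exists>K \<sigma>. K \<in> Q \<and> (([p], \<lambda>_. 0), (K, \<sigma>)) \<in> astep\<^sup>* \<and> rest K \<sigma> C')"
    using good_reachable unfolding good_def by blast
  have "(C, y) \<notin> det" for y
    using C(2) by (auto simp: det_def halted_def)
  then have "C' = C" using chain by (auto elim: converse_rtranclE)
  with C' C(3) obtain K \<sigma> where K: "(([p], \<lambda>_. 0), (K, \<sigma>)) \<in> astep\<^sup>*" "rest K \<sigma> C"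
    unfolding dead_def by blast
  have "K = []" using K(2) C(3) by (auto simp: rest_def conf_def machine_def)
  with K(1) show "\<exists>\<sigma>. (\<lambda>_. 0, \<sigma>) \<in> sem (act_rel x) p"
    unfolding prog_steps_iff[symmetric] by blast
next
  assume "\<exists>\<sigma>. (\<lambda>_. 0, \<sigma>) \<in> sem (act_rel x) p"
  then obtain \<sigma> where run: "(([p], \<lambda>_. 0), ([], \<sigma>)) \<in> astep\<^sup>*"
    unfolding prog_steps_iff[symmetric] by blast
  obtain C where C: "(initial M, C) \<in> det" "rest [p] (\<lambda>_. 0) C" by (rule initial_det)
  have "[p] \<in> Q" using conts_self by blast
  then obtain C' where C': "(C, C') \<in> (steps M x)\<^sup>*" "rest [] \<sigma> C'"
    using rest_steps_complete[OF run C(2)] by blast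
  from C have "(initial M, C) \<in> steps M x" by (auto simp: det_def)
  with C' have "(initial M, C') \<in> (steps M x)\<^sup>*" by (meson converse_rtrancl_into_rtrancl)
  moreover have "halted M x C'" "state C' = accept M"
  proof -
    obtain cols where "represents m x cols \<sigma>" and eq: "C' = conf (Rest []) (\<sigma> 0) (tape cols) 0"
      using C'(2) by (auto simp: rest_def)
    then have "steps M x `` {C'} = {}" using rest_successors[of cols \<sigma> "[]"] by simp
    then show "halted M x C'" by (auto simp: halted_def)
    show "state C' = accept M" using eq by (simp add: conf_def machine_def)
  qed
  ultimately show "accepts M x" by (auto simp: accepts_def)
qed

end


section \<open>Logarithmic space and token programs\<close>

lemma valid_action_mono: "valid_action m b \<Longrightarrow> m \<le> m' \<Longrightarrow> valid_action m' b"
  by (cases b) auto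

lemma ex_valid_action:
  assumes "\<forall>j. b \<noteq> Assign 0 j"
  shows "\<exists>m>0. valid_action m b"
proof (cases b)
  case (Assign i j)
  then show ?thesis using assms by (intro exI[of _ "Suc (i + j)"]) (cases i; auto)
next
  case (Test i j)
  then show ?thesis by (intro exI[of _ "Suc (i + j)"]) auto
qed auto

lemma ex_valid_actions:
  "finite B \<Longrightarrow> \<forall>j. Assign 0 j \<notin> B \<Longrightarrow> \<exists>m>0. \<forall>b\<in>B. valid_action m b"
proof (induction rule: finite_induct)
  case (insert b B)
  then obtain m m' where "m > 0" "\<forall>b\<in>B. valid_action m b" "m' > 0" "valid_action m' b"
    using ex_valid_action[of b] by blast
  then show ?case
    by (intro exI[of _ "max m m'"]) (auto intro: valid_action_mono)
qed auto

definition log_space :: "nat \<Rightarrow> nat" where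
  "log_space n = nat \<lfloor>log 2 (real (Suc n))\<rfloor> + 4"

lemma log_space_bound: "2 ^ l \<le> Suc n \<Longrightarrow> l + 3 < log_space n"
proof -
  assume "2 ^ l \<le> Suc n"
  then have "(2::real) ^ l \<le> real (Suc n)"
    by (metis of_nat_le_iff of_nat_numeral of_nat_power)
  then have "real l \<le> log 2 (real (Suc n))"
    by (simp add: le_log_iff powr_realpow)
  then have "l \<le> nat \<lfloor>log 2 (real (Suc n))\<rfloor>"
    by (simp add: le_nat_floor)
  then show ?thesis by (simp add: log_space_def)
qed

lemma log_space_bigo: "(\<lambda>n. real (log_space n)) \<in> O(\<lambda>n. ln (real n))"
proof (rule bigoI[of _ "6 / ln 2"], rule eventually_sequentiallyI[of 2])
  fix n :: nat assume n: "2 \<le> n"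
  have "real (Suc n) \<le> real n ^ 2"
  proof -
    have "Suc n \<le> 2 * n" "2 * n \<le> n * n" using n by auto
    then have "Suc n \<le> n ^ 2" unfolding power2_eq_square by (rule le_trans)
    then show ?thesis by (metis of_nat_le_iff of_nat_power)
  qed
  then have 1: "ln (real (Suc n)) \<le> 2 * ln (real n)"
    using n by (metis ln_mono ln_realpow of_nat_0_less_iff of_nat_numeral zero_less_Suc
      less_le_trans zero_less_numeral)
  have 2: "ln 2 \<le> ln (real n)" using n by simp
  have "0 \<le> log 2 (real (Suc n))" by simp
  then have "real (log_space n) \<le> log 2 (real (Suc n)) + 4"
    by (simp add: log_space_def)
  also have "\<dots> \<le> 2 * ln (real n) / ln 2 + 4 * (ln (real n) / ln 2)"
  proof -
    have "log 2 (real (Suc n)) \<le> 2 * ln (real n) / ln 2"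
      unfolding log_def using 1 by (intro divide_right_mono) auto
    moreover have "1 \<le> ln (real n) / ln 2" using 2 by (simp add: le_divide_eq)
    ultimately show ?thesis by linarith
  qed
  also have "\<dots> = 6 / ln 2 * ln (real n)" by (simp add: field_simps)
  also have "\<dots> = 6 / ln 2 * norm (ln (real n))" using n by simp
  finally show "norm (real (log_space n)) \<le> 6 / ln 2 * norm (ln (real n))" by simp
qed

lemma prog_in_NL:
  assumes "\<forall>j. Assign 0 j \<notin> set_prog p"
  shows "{x. \<exists>\<sigma>. (\<lambda>_. 0, \<sigma>) \<in> sem (act_rel x) p} \<in> NL"
proof -
  have "finite (set_prog p)" by (induction p) auto
  then obtain m where m: "m > 0" "\<forall>b\<in>set_prog p. valid_action m b"
    using ex_valid_actions assms by blast
  have sw: "sweeping m p x (log_space (length x))" for x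
    using m log_space_bound by unfold_locales auto
  show ?thesis
    unfolding NL_def NSPACE_def mem_Collect_eq
    using turing_machine_machine log_space_bigo sweeping.uses_space[OF sw] sweeping.accepts_iff[OF sw]
    by (intro exI[of _ "machine m p"] exI[of _ log_space]) auto
qed

datatype token_action = Tok token | Copy nat nat

fun token_rel :: "token_action \<Rightarrow> (nat \<Rightarrow> token list) rel" where
  "token_rel (Tok t) = {(\<tau>, \<tau>(0 := r)) | \<tau> r. \<tau> 0 = t # r}"
| "token_rel (Copy i j) = {(\<tau>, \<tau>(i := \<tau> j)) | \<tau>. True}"

lemma act_rel_iff:
  "(\<sigma>, \<sigma>') \<in> act_rel x (Read a) \<longleftrightarrow> read_input x (\<sigma> 0) = a \<and> \<sigma>' = \<sigma>"
  "(\<sigma>, \<sigma>') \<in> act_rel x GoLeft \<longleftrightarrow> 0 < \<sigma> 0 \<and> \<sigma>' = \<sigma>(0 := \<sigma> 0 - 1)"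
  "(\<sigma>, \<sigma>') \<in> act_rel x GoRight \<longleftrightarrow> \<sigma> 0 \<le> length x \<and> \<sigma>' = \<sigma>(0 := Suc (\<sigma> 0))"
  "(\<sigma>, \<sigma>') \<in> act_rel x (Assign i j) \<longleftrightarrow> \<sigma>' = \<sigma>(i := \<sigma> j)"
  "(\<sigma>, \<sigma>') \<in> act_rel x (Test i j) \<longleftrightarrow> \<sigma> i = \<sigma> j \<and> \<sigma>' = \<sigma>"
  by auto

definition scan :: "bool list \<Rightarrow> action prog" where
  "scan bs = foldr (\<lambda>b p. Seq (Seq (Atom GoRight) (Atom (Read (Letter b)))) p) bs (Star Fail)"

definition seek :: "nat \<Rightarrow> action prog" where
  "seek j = Seq (Star (Choice (Atom GoLeft) (Atom GoRight))) (Atom (Test 0 j))"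

fun compile :: "token_action prog \<Rightarrow> action prog" where
  "compile (Atom (Tok t)) = scan (token_code t)"
| "compile (Atom (Copy i j)) =
     (if i = 0 then if j = 0 then Star Fail else seek j else Atom (Assign i j))"
| "compile Fail = Fail"
| "compile (Seq p q) = Seq (compile p) (compile q)"
| "compile (Choice p q) = Choice (compile p) (compile q)"
| "compile (Star p) = Star (compile p)"

lemma compile_no_assign: "Assign 0 j \<notin> set_prog (compile p)"
proof -
  have "Assign 0 j \<notin> set_prog (scan bs)" for bs
    by (induction bs) (auto simp: scan_def)
  then show ?thesis
    by (induction p rule: compile.induct) (auto simp: seek_def)
qed

lemma sem_scan:
  "(\<sigma>, \<sigma>') \<in> sem (act_rel x) (scan bs) \<longleftrightarrow>
     prefix bs (drop (\<sigma> 0) x) \<and> \<sigma>' = \<sigma>(0 := \<sigma> 0 + length bs)"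
proof (induction bs arbitrary: \<sigma>)
  case Nil
  then show ?case by (auto simp: scan_def)
next
  case (Cons b bs)
  have step: "(\<sigma>, \<rho>) \<in> act_rel x GoRight O act_rel x (Read (Letter b)) \<longleftrightarrow>
    \<sigma> 0 < length x \<and> x ! \<sigma> 0 = b \<and> \<rho> = \<sigma>(0 := Suc (\<sigma> 0))" for \<rho>
    by (auto simp: relcomp_unfold act_rel_iff read_input_def split: if_splits)
  have "(\<sigma>, \<sigma>') \<in> sem (act_rel x) (scan (b # bs)) \<longleftrightarrow>
    (\<exists>\<rho>. (\<sigma>, \<rho>) \<in> act_rel x GoRight O act_rel x (Read (Letter b)) \<and>
      (\<rho>, \<sigma>') \<in> sem (act_rel x) (scan bs))"
    by (auto simp: scan_def)
  also have "\<dots> \<longleftrightarrow> \<sigma> 0 < length x \<and> x ! \<sigma> 0 = b \<and> prefix bs (drop (Suc (\<sigma> 0)) x) \<and>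
      \<sigma>' = \<sigma>(0 := \<sigma> 0 + length (b # bs))"
    unfolding step Cons.IH by auto
  also have "\<dots> \<longleftrightarrow> prefix (b # bs) (drop (\<sigma> 0) x) \<and> \<sigma>' = \<sigma>(0 := \<sigma> 0 + length (b # bs))"
  proof (cases "\<sigma> 0 < length x")
    case True
    then have "drop (\<sigma> 0) x = x ! \<sigma> 0 # drop (Suc (\<sigma> 0)) x"
      by (simp add: Cons_nth_drop_Suc)
    then show ?thesis using True by auto
  qed simp
  finally show ?case .
qed

lemma sem_wander:
  assumes "\<sigma> 0 \<le> Suc (length x)"
  shows "(\<sigma>, \<sigma>') \<in> sem (act_rel x) (Star (Choice (Atom GoLeft) (Atom GoRight))) \<longleftrightarrow>
    (\<exists>q\<le>Suc (length x). \<sigma>' = \<sigma>(0 := q))"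
proof
  assume "(\<sigma>, \<sigma>') \<in> sem (act_rel x) (Star (Choice (Atom GoLeft) (Atom GoRight)))"
  then have "(\<sigma>, \<sigma>') \<in> (act_rel x GoLeft \<union> act_rel x GoRight)\<^sup>*" by simp
  then show "\<exists>q\<le>Suc (length x). \<sigma>' = \<sigma>(0 := q)"
  proof (induction rule: rtrancl_induct)
    case base
    show ?case using assms by (intro exI[of _ "\<sigma> 0"]) auto
  next
    case (step \<rho> \<rho>')
    then obtain q where q: "q \<le> Suc (length x)" "\<rho> = \<sigma>(0 := q)" by blast
    from step(2) consider "\<rho>' = \<sigma>(0 := q - 1)" | "\<rho>' = \<sigma>(0 := Suc q)" "q \<le> length x"
      unfolding q(2) Un_iff act_rel_iff by auto
    then show ?case
    proof cases
      case 1
      then show ?thesis using q(1) by (intro exI[of _ "q - 1"]) auto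
    next
      case 2
      then show ?thesis by (intro exI[of _ "Suc q"]) auto
    qed
  qed
next
  let ?R = "act_rel x GoLeft \<union> act_rel x GoRight"
  have up: "(\<sigma>(0 := a), \<sigma>(0 := a + d)) \<in> ?R\<^sup>*" if "a + d \<le> Suc (length x)" for a d
    using that
  proof (induction d)
    case (Suc d)
    then have "(\<sigma>(0 := a + d), \<sigma>(0 := a + Suc d)) \<in> ?R"
      by (intro UnI2) (simp add: act_rel_iff del: act_rel.simps)
    moreover have "(\<sigma>(0 := a), \<sigma>(0 := a + d)) \<in> ?R\<^sup>*" using Suc by linarith
    ultimately show ?case by (rule rtrancl_into_rtrancl[rotated])
  qed simp
  have down: "(\<sigma>(0 := a + d), \<sigma>(0 := a)) \<in> ?R\<^sup>*" for a d
  proof (induction d)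
    case (Suc d)
    have "(\<sigma>(0 := a + Suc d), \<sigma>(0 := a + d)) \<in> ?R"
      by (intro UnI1) (simp add: act_rel_iff del: act_rel.simps)
    then show ?case using Suc by (rule converse_rtrancl_into_rtrancl)
  qed simp
  assume "\<exists>q\<le>Suc (length x). \<sigma>' = \<sigma>(0 := q)"
  then obtain q where q: "q \<le> Suc (length x)" "\<sigma>' = \<sigma>(0 := q)" by blast
  have "(\<sigma>(0 := \<sigma> 0), \<sigma>(0 := q)) \<in> ?R\<^sup>*"
    using up[of "\<sigma> 0" "q - \<sigma> 0"] down[of q "\<sigma> 0 - q"] q(1) by (cases "\<sigma> 0 \<le> q") auto
  then show "(\<sigma>, \<sigma>') \<in> sem (act_rel x) (Star (Choice (Atom GoLeft) (Atom GoRight)))"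
    using q(2) by simp
qed

lemma sem_seek:
  assumes "\<sigma> 0 \<le> Suc (length x)" "\<sigma> j \<le> Suc (length x)" "j \<noteq> 0"
  shows "(\<sigma>, \<sigma>') \<in> sem (act_rel x) (seek j) \<longleftrightarrow> \<sigma>' = \<sigma>(0 := \<sigma> j)"
proof -
  have "(\<sigma>, \<sigma>') \<in> sem (act_rel x) (seek j) \<longleftrightarrow>
    (\<exists>\<rho>. (\<exists>q\<le>Suc (length x). \<rho> = \<sigma>(0 := q)) \<and> (\<rho>, \<sigma>') \<in> act_rel x (Test 0 j))"
    unfolding seek_def sem_wander[of \<sigma> x, OF assms(1), symmetric] by auto
  also have "\<dots> \<longleftrightarrow> \<sigma>' = \<sigma>(0 := \<sigma> j)"
    using assms by auto
  finally show ?thesis .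
qed

definition word :: "token list \<Rightarrow> bool list" where
  "word ts = concat (map token_code ts)"

lemma length_token_code [simp]: "length (token_code t) = 3"
  by (cases t) auto

lemma token_code_inject [simp]: "token_code t = token_code t' \<longleftrightarrow> t = t'"
  by (cases t; cases t') auto

lemma length_word [simp]: "length (word ts) = 3 * length ts"
  by (induction ts) (auto simp: word_def)

lemma prefix_token_code: "prefix (token_code t) (word r) \<longleftrightarrow> (\<exists>r'. r = t # r')"
proof (cases r)
  case Nil
  then show ?thesis using length_token_code[of t] by (auto simp: word_def simp del: length_token_code)
next
  case (Cons t' r')
  have "prefix (token_code t) (token_code t' @ word r') \<longleftrightarrow> token_code t = token_code t'"
    by (metis append_eq_append_conv length_token_code prefix_def)
  then show ?thesis using Cons by (auto simp: word_def)
qed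

text \<open>A register of the token machine holds a suffix of the input; it is stored as a cell number.\<close>

definition position :: "token list \<Rightarrow> token list \<Rightarrow> nat" where
  "position ts r = 3 * (length ts - length r)"

definition stores :: "token list \<Rightarrow> (nat \<Rightarrow> token list) \<Rightarrow> (nat \<Rightarrow> nat) \<Rightarrow> bool" where
  "stores ts \<tau> \<sigma> \<longleftrightarrow> (\<forall>i. suffix (\<tau> i) ts) \<and> \<sigma> = position ts \<circ> \<tau>"

lemma drop_word: "suffix r ts \<Longrightarrow> drop (position ts r) (word ts) = word r"
proof -
  assume "suffix r ts"
  then obtain pre where "ts = pre @ r" by (auto simp: suffix_def)
  then show ?thesis by (simp add: position_def word_def flip: length_word[unfolded word_def])
qed

lemma token_rel_suffix:
  assumes "(\<tau>, \<tau>') \<in> token_rel a" "\<forall>i. suffix (\<tau> i) ts"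
  shows "\<forall>i. suffix (\<tau>' i) ts"
proof (cases a)
  case (Tok t)
  with assms obtain r where r: "\<tau> 0 = t # r" "\<tau>' = \<tau>(0 := r)" by auto
  then have "suffix (t # r) ts" using assms(2) by metis
  then show ?thesis using r assms(2) by (auto dest: suffix_ConsD)
qed (use assms in auto)

lemma atom_sim:
  assumes "stores ts \<tau> \<sigma>"
  shows "(\<sigma>, \<sigma>') \<in> sem (act_rel (word ts)) (compile (Atom a)) \<longleftrightarrow>
    (\<exists>\<tau>'. (\<tau>, \<tau>') \<in> token_rel a \<and> stores ts \<tau>' \<sigma>')"
proof (cases a)
  case (Tok t)
  have suf: "suffix (\<tau> 0) ts" and \<sigma>: "\<sigma> = position ts \<circ> \<tau>"
    using assms by (auto simp: stores_def)
  have "(\<sigma>, \<sigma>') \<in> sem (act_rel (word ts)) (compile (Atom a)) \<longleftrightarrow>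
    (\<exists>r. \<tau> 0 = t # r) \<and> \<sigma>' = \<sigma>(0 := \<sigma> 0 + 3)"
    using Tok \<sigma> drop_word[OF suf] by (simp add: sem_scan prefix_token_code)
  also have "\<dots> \<longleftrightarrow> (\<exists>r. \<tau> 0 = t # r \<and> \<sigma>' = position ts \<circ> \<tau>(0 := r))"
  proof -
    have "\<sigma>(0 := \<sigma> 0 + 3) = position ts \<circ> \<tau>(0 := r)" if "\<tau> 0 = t # r" for r
    proof -
      have "length (\<tau> 0) \<le> length ts" using suf by (rule suffix_length_le)
      then show ?thesis using \<sigma> that by (auto simp: position_def fun_eq_iff)
    qed
    then show ?thesis by auto
  qed
  also have "\<dots> \<longleftrightarrow> (\<exists>\<tau>'. (\<tau>, \<tau>') \<in> token_rel a \<and> stores ts \<tau>' \<sigma>')"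
  proof -
    have "\<forall>i. suffix ((\<tau>(0 := r)) i) ts" if "\<tau> 0 = t # r" for r
      using assms that token_rel_suffix[of \<tau> "\<tau>(0 := r)" "Tok t" ts] by (auto simp: stores_def)
    then show ?thesis using Tok unfolding stores_def by auto
  qed
  finally show ?thesis .
next
  case (Copy i j)
  have le: "\<sigma> l \<le> Suc (length (word ts))" for l
    using assms by (auto simp: stores_def position_def)
  have "(\<sigma>, \<sigma>') \<in> sem (act_rel (word ts)) (compile (Atom a)) \<longleftrightarrow> \<sigma>' = \<sigma>(i := \<sigma> j)"
    using Copy sem_seek[OF le le] by auto
  also have "\<dots> \<longleftrightarrow> (\<exists>\<tau>'. (\<tau>, \<tau>') \<in> token_rel a \<and> stores ts \<tau>' \<sigma>')"
    using Copy assms token_rel_suffix[of \<tau> "\<tau>(i := \<tau> j)" a ts] by (auto simp: stores_def fun_upd_comp)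
  finally show ?thesis .
qed

lemma compile_sound:
  "(\<sigma>, \<sigma>') \<in> sem (act_rel (word ts)) (compile p) \<Longrightarrow> stores ts \<tau> \<sigma> \<Longrightarrow>
     \<exists>\<tau>'. (\<tau>, \<tau>') \<in> sem token_rel p \<and> stores ts \<tau>' \<sigma>'"
proof (induction p arbitrary: \<sigma> \<sigma>' \<tau>)
  case (Atom a)
  then show ?case using atom_sim by (metis sem.simps(1))
next
  case (Seq p q)
  then show ?case by simp (meson relcomp.simps)
next
  case (Choice p q)
  then show ?case by simp blast
next
  case (Star p)
  from Star.prems(1) have "(\<sigma>, \<sigma>') \<in> (sem (act_rel (word ts)) (compile p))\<^sup>*" by simp
  then have "\<exists>\<tau>'. (\<tau>, \<tau>') \<in> (sem token_rel p)\<^sup>* \<and> stores ts \<tau>' \<sigma>'"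
  proof (induction rule: rtrancl_induct)
    case base
    then show ?case using Star.prems by blast
  next
    case (step y z)
    then show ?case using Star.IH by (meson rtrancl_into_rtrancl)
  qed
  then show ?case by simp
qed simp

lemma compile_complete:
  "(\<tau>, \<tau>') \<in> sem token_rel p \<Longrightarrow> stores ts \<tau> \<sigma> \<Longrightarrow>
     \<exists>\<sigma>'. (\<sigma>, \<sigma>') \<in> sem (act_rel (word ts)) (compile p) \<and> stores ts \<tau>' \<sigma>'"
proof (induction p arbitrary: \<sigma> \<tau> \<tau>')
  case (Atom a)
  have "stores ts \<tau>' (position ts \<circ> \<tau>')"
    using Atom token_rel_suffix by (auto simp: stores_def)
  with Atom atom_sim[OF Atom(2)] show ?case by auto
next
  case (Seq p q)
  then show ?case by simp (meson relcomp.simps)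
next
  case (Choice p q)
  then show ?case by simp blast
next
  case (Star p)
  from Star.prems(1) have "(\<tau>, \<tau>') \<in> (sem token_rel p)\<^sup>*" by simp
  then have "\<exists>\<sigma>'. (\<sigma>, \<sigma>') \<in> (sem (act_rel (word ts)) (compile p))\<^sup>* \<and> stores ts \<tau>' \<sigma>'"
  proof (induction rule: rtrancl_induct)
    case base
    then show ?case using Star.prems by blast
  next
    case (step y z)
    then show ?case using Star.IH by (meson rtrancl_into_rtrancl)
  qed
  then show ?case by simp
qed simp

lemma token_prog_in_NL:
  "\<exists>L\<in>NL. \<forall>ts. word ts \<in> L \<longleftrightarrow> (\<exists>\<tau>. (\<lambda>_. ts, \<tau>) \<in> sem token_rel p)"
proof
  let ?L = "{x. \<exists>\<sigma>. (\<lambda>_. 0, \<sigma>) \<in> sem (act_rel x) (compile p)}"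
  show "?L \<in> NL" by (rule prog_in_NL) (simp add: compile_no_assign)
  have "stores ts (\<lambda>_. ts) (\<lambda>_. 0)" for ts
    by (simp add: stores_def position_def fun_eq_iff)
  then show "\<forall>ts. word ts \<in> ?L \<longleftrightarrow> (\<exists>\<tau>. (\<lambda>_. ts, \<tau>) \<in> sem token_rel p)"
    using compile_sound compile_complete by blast
qed


section \<open>Reading numbers and lists\<close>

abbreviation "tsem \<equiv> sem token_rel"

abbreviation "tok t \<equiv> Atom (Tok t)"

abbreviation "copy i j \<equiv> Atom (Copy i j)"

definition skip_number :: "token_action prog" where
  "skip_number = Seq (Star (Choice (tok (Bit True)) (tok (Bit False)))) (tok Sep)"

definition skip_list :: "token_action prog" where
  "skip_list = Seq (Star skip_number) (tok End)"

definition both :: "token \<Rightarrow> token_action prog" where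
  "both t = seqs [copy 0 1, tok t, copy 1 0, copy 0 2, tok t, copy 2 0]"

definition match :: "nat \<Rightarrow> token_action prog" where
  "match i = seqs [copy 1 0, copy 2 i, Star (Choice (both (Bit True)) (both (Bit False))),
     both Sep, copy 0 1]"

lemma bits_Sep_inject:
  "map Bit w @ Sep # r = map Bit w' @ Sep # r' \<longleftrightarrow> w = w' \<and> r = r'"
proof (induction w arbitrary: w')
  case Nil
  then show ?case by (cases w') auto
next
  case (Cons b w)
  then show ?case by (cases w') auto
qed

lemma tsem_bits:
  "(\<tau>, \<tau>') \<in> (tsem (Choice (tok (Bit True)) (tok (Bit False))))\<^sup>* \<longleftrightarrow>
     (\<exists>w r. \<tau> 0 = map Bit w @ r \<and> \<tau>' = \<tau>(0 := r))"
proof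
  assume "(\<tau>, \<tau>') \<in> (tsem (Choice (tok (Bit True)) (tok (Bit False))))\<^sup>*"
  then show "\<exists>w r. \<tau> 0 = map Bit w @ r \<and> \<tau>' = \<tau>(0 := r)"
  proof (induction rule: rtrancl_induct)
    case base
    show ?case by (intro exI[of _ "[]"] exI[of _ "\<tau> 0"]) auto
  next
    case (step \<rho> \<rho>')
    then obtain w r where w: "\<tau> 0 = map Bit w @ r" "\<rho> = \<tau>(0 := r)" by blast
    with step(2) obtain b r' where "r = Bit b # r'" "\<rho>' = \<tau>(0 := r')" by auto
    with w show ?case by (intro exI[of _ "w @ [b]"] exI[of _ r']) auto
  qed
next
  assume "\<exists>w r. \<tau> 0 = map Bit w @ r \<and> \<tau>' = \<tau>(0 := r)"
  then obtain w r where "\<tau> 0 = map Bit w @ r" "\<tau>' = \<tau>(0 := r)" by blast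
  then show "(\<tau>, \<tau>') \<in> (tsem (Choice (tok (Bit True)) (tok (Bit False))))\<^sup>*"
  proof (induction w arbitrary: \<tau>)
    case Nil
    then have "\<tau>' = \<tau>" by auto
    then show ?case by simp
  next
    case (Cons b w)
    have "(\<tau>, \<tau>(0 := map Bit w @ r)) \<in> tsem (Choice (tok (Bit True)) (tok (Bit False)))"
      using Cons.prems by (cases b) auto
    moreover have "(\<tau>(0 := map Bit w @ r), \<tau>') \<in> (tsem (Choice (tok (Bit True)) (tok (Bit False))))\<^sup>*"
      using Cons.prems by (intro Cons.IH) auto
    ultimately show ?case by (rule converse_rtrancl_into_rtrancl)
  qed
qed

lemma tsem_skip_number:
  "(\<tau>, \<tau>') \<in> tsem skip_number \<longleftrightarrow> (\<exists>w r. \<tau> 0 = map Bit w @ Sep # r \<and> \<tau>' = \<tau>(0 := r))"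
proof -
  have "(\<tau>, \<tau>') \<in> tsem skip_number \<longleftrightarrow> (\<exists>\<rho>.
    (\<tau>, \<rho>) \<in> (tsem (Choice (tok (Bit True)) (tok (Bit False))))\<^sup>* \<and> (\<rho>, \<tau>') \<in> token_rel (Tok Sep))"
    unfolding skip_number_def by auto
  also have "\<dots> \<longleftrightarrow> (\<exists>w r. \<tau> 0 = map Bit w @ Sep # r \<and> \<tau>' = \<tau>(0 := r))"
    unfolding tsem_bits by fastforce
  finally show ?thesis .
qed

lemma skip_number_exact:
  "\<tau> 0 = number_tokens n @ r \<Longrightarrow> (\<tau>, \<tau>') \<in> tsem skip_number \<longleftrightarrow> \<tau>' = \<tau>(0 := r)"
  by (auto simp: tsem_skip_number number_tokens_def bits_Sep_inject)

lemma skip_number_End: "\<tau> 0 = End # r \<Longrightarrow> (\<tau>, \<tau>') \<notin> tsem skip_number"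
  by (auto simp: tsem_skip_number Cons_eq_append_conv)

lemma star_items:
  assumes item: "\<And>a r \<tau> \<tau>'. \<tau> 0 = f a @ r \<Longrightarrow> (\<tau>, \<tau>') \<in> R \<longleftrightarrow> \<tau>' = \<tau>(0 := r)"
    and stop: "\<And>r \<tau> \<tau>'. \<tau> 0 = End # r \<Longrightarrow> (\<tau>, \<tau>') \<notin> R"
    and \<tau>: "\<tau> (0::nat) = concat (map f as) @ End # r"
  shows "(\<tau>, \<tau>') \<in> R\<^sup>* \<longleftrightarrow> (\<exists>bs cs. as = bs @ cs \<and> \<tau>' = \<tau>(0 := concat (map f cs) @ End # r))"
proof
  assume "(\<tau>, \<tau>') \<in> R\<^sup>*"
  then show "\<exists>bs cs. as = bs @ cs \<and> \<tau>' = \<tau>(0 := concat (map f cs) @ End # r)"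
  proof (induction rule: rtrancl_induct)
    case base
    show ?case using \<tau> by (intro exI[of _ "[]"] exI[of _ as]) auto
  next
    case (step \<rho> \<rho>')
    then obtain bs cs where cs: "as = bs @ cs" "\<rho> = \<tau>(0 := concat (map f cs) @ End # r)" by blast
    show ?case
    proof (cases cs)
      case Nil
      then show ?thesis using stop[of \<rho> r \<rho>'] cs step(2) by simp
    next
      case (Cons c cs')
      then have "\<rho>' = \<tau>(0 := concat (map f cs') @ End # r)"
        using item[of \<rho> c "concat (map f cs') @ End # r" \<rho>'] cs step(2) by simp
      then show ?thesis using cs Cons by (intro exI[of _ "bs @ [c]"] exI[of _ cs']) auto
    qed
  qed
next
  assume "\<exists>bs cs. as = bs @ cs \<and> \<tau>' = \<tau>(0 := concat (map f cs) @ End # r)"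
  then obtain bs cs where "as = bs @ cs" "\<tau>' = \<tau>(0 := concat (map f cs) @ End # r)" by blast
  with \<tau> show "(\<tau>, \<tau>') \<in> R\<^sup>*"
  proof (induction bs arbitrary: \<tau> as)
    case Nil
    then have "\<tau>' = \<tau>" by auto
    then show ?case by simp
  next
    case (Cons b bs)
    let ?\<rho> = "\<tau>(0 := concat (map f (bs @ cs)) @ End # r)"
    have "(\<tau>, ?\<rho>) \<in> R" using item[of \<tau> b "concat (map f (bs @ cs)) @ End # r"] Cons.prems by simp
    moreover have "(?\<rho>, \<tau>') \<in> R\<^sup>*" using Cons.prems by (intro Cons.IH[of ?\<rho> "bs @ cs"]) auto
    ultimately show ?case by (rule converse_rtrancl_into_rtrancl)
  qed
qed

lemma concat_number_tokens_End:
  "concat (map number_tokens ns) @ End # r = End # r' \<longleftrightarrow> ns = [] \<and> r = r'"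
  by (cases ns) (auto simp: number_tokens_def Cons_eq_append_conv append_eq_Cons_conv)

lemma tsem_skip_numbers:
  "\<tau> 0 = list_tokens ns @ r \<Longrightarrow> (\<tau>, \<tau>') \<in> (tsem skip_number)\<^sup>* \<longleftrightarrow>
     (\<exists>bs cs. ns = bs @ cs \<and> \<tau>' = \<tau>(0 := list_tokens cs @ r))"
  using star_items[of number_tokens "tsem skip_number" \<tau> ns r \<tau>'] skip_number_exact skip_number_End
  by (simp add: list_tokens_def)

lemma skip_list_exact:
  assumes "\<tau> 0 = list_tokens ns @ r"
  shows "(\<tau>, \<tau>') \<in> tsem skip_list \<longleftrightarrow> \<tau>' = \<tau>(0 := r)"
proof -
  have "(\<tau>, \<tau>') \<in> tsem skip_list \<longleftrightarrow>
    (\<exists>\<rho>. (\<tau>, \<rho>) \<in> (tsem skip_number)\<^sup>* \<and> (\<rho>, \<tau>') \<in> token_rel (Tok End))"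
    unfolding skip_list_def by auto
  also have "\<dots> \<longleftrightarrow> \<tau>' = \<tau>(0 := r)"
  proof
    assume "\<exists>\<rho>. (\<tau>, \<rho>) \<in> (tsem skip_number)\<^sup>* \<and> (\<rho>, \<tau>') \<in> token_rel (Tok End)"
    then obtain cs \<rho> where "\<rho> = \<tau>(0 := list_tokens cs @ r)" "(\<rho>, \<tau>') \<in> token_rel (Tok End)"
      unfolding tsem_skip_numbers[of \<tau>, OF assms] by blast
    then show "\<tau>' = \<tau>(0 := r)"
      by (auto simp: list_tokens_def concat_number_tokens_End)
  next
    assume "\<tau>' = \<tau>(0 := r)"
    then have "(\<tau>(0 := list_tokens [] @ r), \<tau>') \<in> token_rel (Tok End)"
      by (auto simp: list_tokens_def)
    then show "\<exists>\<rho>. (\<tau>, \<rho>) \<in> (tsem skip_number)\<^sup>* \<and> (\<rho>, \<tau>') \<in> token_rel (Tok End)"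
      unfolding tsem_skip_numbers[of \<tau>, OF assms] by blast
  qed
  finally show ?thesis .
qed

lemma tsem_both:
  "(\<tau>, \<tau>') \<in> tsem (both t) \<longleftrightarrow>
     (\<exists>r1 r2. \<tau> 1 = t # r1 \<and> \<tau> 2 = t # r2 \<and> \<tau>' = \<tau>(1 := r1, 2 := r2, 0 := r2))"
  unfolding both_def by (auto simp: relcomp_unfold fun_upd_twist)

lemma tsem_both_bits:
  "(\<tau>, \<tau>') \<in> (tsem (both (Bit True)) \<union> tsem (both (Bit False)))\<^sup>* \<Longrightarrow>
     \<exists>w r1 r2. \<tau> 1 = map Bit w @ r1 \<and> \<tau> 2 = map Bit w @ r2 \<and> \<tau>' = \<tau>(1 := r1, 2 := r2, 0 := \<tau>' 0)"
proof (induction rule: rtrancl_induct)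
  case base
  show ?case by (intro exI[of _ "[]"] exI[of _ "\<tau> 1"] exI[of _ "\<tau> 2"]) auto
next
  case (step \<rho> \<rho>')
  then obtain w r1 r2 where w: "\<tau> 1 = map Bit w @ r1" "\<tau> 2 = map Bit w @ r2"
    and \<rho>: "\<rho> = \<tau>(1 := r1, 2 := r2, 0 := \<rho> 0)" by blast
  from \<rho> have "\<rho> 1 = r1" "\<rho> 2 = r2" by (metis fun_upd_apply zero_neq_one zero_neq_numeral
    one_eq_numeral_iff semiring_norm(85))+
  with step(2) obtain b r1' r2' where "r1 = Bit b # r1'" "r2 = Bit b # r2'"
    "\<rho>' = \<rho>(1 := r1', 2 := r2', 0 := r2')" by (auto simp: tsem_both)
  moreover from this have "\<rho>' = \<tau>(1 := r1', 2 := r2', 0 := \<rho>' 0)"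
    by (subst (asm) \<rho>) (auto simp: fun_eq_iff)
  ultimately show ?case using w by (intro exI[of _ "w @ [b]"] exI[of _ r1'] exI[of _ r2']) auto
qed

lemma tsem_both_bits_complete:
  "\<tau> 1 = map Bit w @ r1 \<Longrightarrow> \<tau> 2 = map Bit w @ r2 \<Longrightarrow>
     \<exists>z. (\<tau>, \<tau>(1 := r1, 2 := r2, 0 := z)) \<in> (tsem (both (Bit True)) \<union> tsem (both (Bit False)))\<^sup>*"
proof (induction w arbitrary: \<tau>)
  case Nil
  then have "\<tau>(1 := r1, 2 := r2, 0 := \<tau> 0) = \<tau>" by auto
  then show ?case by (metis rtrancl.rtrancl_refl)
next
  case (Cons b w)
  let ?\<rho> = "\<tau>(1 := map Bit w @ r1, 2 := map Bit w @ r2, 0 := map Bit w @ r2)"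
  have "(\<tau>, ?\<rho>) \<in> tsem (both (Bit b))" using Cons.prems by (simp add: tsem_both)
  then have "(\<tau>, ?\<rho>) \<in> tsem (both (Bit True)) \<union> tsem (both (Bit False))" by (cases b) auto
  moreover have "?\<rho> 1 = map Bit w @ r1" "?\<rho> 2 = map Bit w @ r2" by auto
  from Cons.IH[OF this] obtain z where "(?\<rho>, ?\<rho>(1 := r1, 2 := r2, 0 := z)) \<in>
      (tsem (both (Bit True)) \<union> tsem (both (Bit False)))\<^sup>*" by blast
  moreover have "?\<rho>(1 := r1, 2 := r2, 0 := z) = \<tau>(1 := r1, 2 := r2, 0 := z)"
    by (auto simp: fun_eq_iff)
  ultimately show ?case by (metis converse_rtrancl_into_rtrancl)
qed

lemma tsem_match:
  assumes i: "2 < i"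
  shows "(\<tau>, \<tau>') \<in> tsem (match i) \<longleftrightarrow> (\<exists>w r1 r2. \<tau> 0 = map Bit w @ Sep # r1 \<and>
     \<tau> i = map Bit w @ Sep # r2 \<and> \<tau>' = \<tau>(1 := r1, 2 := r2, 0 := r1))" (is "_ \<longleftrightarrow> ?R")
proof -
  let ?\<rho> = "\<tau>(1 := \<tau> 0, 2 := \<tau> i)"
  have "(\<tau>, \<tau>') \<in> tsem (match i) \<longleftrightarrow> (\<exists>\<tau>1 \<tau>2.
    (?\<rho>, \<tau>1) \<in> (tsem (both (Bit True)) \<union> tsem (both (Bit False)))\<^sup>* \<and> (\<tau>1, \<tau>2) \<in> tsem (both Sep) \<and>
    \<tau>' = \<tau>2(0 := \<tau>2 1))" (is "_ \<longleftrightarrow> ?L")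
    using i unfolding match_def by (auto simp: relcomp_unfold)
  also have "?L \<longleftrightarrow> ?R"
  proof
    assume ?L
    then obtain \<tau>1 \<tau>2 where 1: "(?\<rho>, \<tau>1) \<in> (tsem (both (Bit True)) \<union> tsem (both (Bit False)))\<^sup>*"
      and 2: "(\<tau>1, \<tau>2) \<in> tsem (both Sep)" and 3: "\<tau>' = \<tau>2(0 := \<tau>2 1)" by blast
    obtain w q1 q2 where w: "?\<rho> 1 = map Bit w @ q1" "?\<rho> 2 = map Bit w @ q2"
      and \<tau>1: "\<tau>1 = ?\<rho>(1 := q1, 2 := q2, 0 := \<tau>1 0)" using tsem_both_bits[OF 1] by blast
    obtain z where \<tau>1': "\<tau>1 = ?\<rho>(1 := q1, 2 := q2, 0 := z)" using \<tau>1 by blast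
    from 2 obtain r1 r2 where "q1 = Sep # r1" "q2 = Sep # r2" "\<tau>2 = \<tau>1(1 := r1, 2 := r2, 0 := r2)"
      unfolding tsem_both \<tau>1' by auto
    with w 3 \<tau>1' show ?R
      by (intro exI[of _ w] exI[of _ r1] exI[of _ r2]) (auto simp: fun_eq_iff)
  next
    assume ?R
    then obtain w r1 r2 where w: "\<tau> 0 = map Bit w @ Sep # r1" "\<tau> i = map Bit w @ Sep # r2"
      "\<tau>' = \<tau>(1 := r1, 2 := r2, 0 := r1)" by blast
    obtain z where z: "(?\<rho>, ?\<rho>(1 := Sep # r1, 2 := Sep # r2, 0 := z)) \<in>
        (tsem (both (Bit True)) \<union> tsem (both (Bit False)))\<^sup>*"
      using tsem_both_bits_complete[of ?\<rho> w "Sep # r1" "Sep # r2"] w by auto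
    let ?\<tau>1 = "?\<rho>(1 := Sep # r1, 2 := Sep # r2, 0 := z)"
    have "(?\<tau>1, ?\<tau>1(1 := r1, 2 := r2, 0 := r2)) \<in> tsem (both Sep)" by (simp add: tsem_both)
    moreover have "\<tau>' = (?\<tau>1(1 := r1, 2 := r2, 0 := r2))(0 := (?\<tau>1(1 := r1, 2 := r2, 0 := r2)) 1)"
      using w(3) by (auto simp: fun_eq_iff)
    ultimately show ?L using z by blast
  qed
  finally show ?thesis .
qed

definition denotes :: "token list \<Rightarrow> nat \<Rightarrow> bool" where
  "denotes r n \<longleftrightarrow> prefix (number_tokens n) r"

lemma binary_inject [simp]: "binary m = binary n \<longleftrightarrow> m = n"
proof (induction m arbitrary: n rule: less_induct)
  case (less m)
  show ?case
  proof (cases "m = 0 \<or> n = 0")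
    case True
    then show ?thesis using binary.simps[of m] binary.simps[of n] by (auto split: if_splits)
  next
    case False
    then have "binary m = binary n \<longleftrightarrow> odd m = odd n \<and> m div 2 = n div 2"
      using binary.simps[of m] binary.simps[of n] less.IH[of "m div 2" "n div 2"] by simp
    also have "\<dots> \<longleftrightarrow> m = n" by (metis odd_two_times_div_two_succ even_two_times_div_two)
    finally show ?thesis .
  qed
qed

lemma denotes_unique: "denotes r m \<Longrightarrow> denotes r n \<Longrightarrow> m = n"
  by (auto simp: denotes_def number_tokens_def prefix_def bits_Sep_inject)

lemma match_exact:
  assumes "\<tau> 0 = number_tokens n @ r" "2 < i"
  shows "(\<tau>, \<tau>') \<in> tsem (match i) \<longleftrightarrow>
     (\<exists>r'. \<tau> i = number_tokens n @ r' \<and> \<tau>' = \<tau>(1 := r, 2 := r', 0 := r))"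
  unfolding tsem_match[OF assms(2)] using assms(1)
  by (auto simp: number_tokens_def bits_Sep_inject)

lemma match_End: "2 < i \<Longrightarrow> \<tau> 0 = End # r \<Longrightarrow> (\<tau>, \<tau>') \<notin> tsem (match i)"
  by (auto simp: tsem_match Cons_eq_append_conv)


section \<open>Checking arcs of a factored graph\<close>

datatype mode = Skip | Vertex | Arc

fun rel :: "mode \<Rightarrow> factored \<Rightarrow> nat list rel" where
  "rel Skip F = {([], [])}"
| "rel Vertex F = Id_on (pverts (graph_of F))"
| "rel Arc F = parcs (graph_of F)"

fun modes :: "token \<Rightarrow> mode \<Rightarrow> (mode \<times> mode) list" where
  "modes UnionT m = [(m, Skip), (Skip, m)]"
| "modes CartesianT Arc = [(Vertex, Arc), (Arc, Vertex)]"
| "modes _ m = [(m, m)]"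

definition juxtapose :: "'a list rel \<Rightarrow> 'a list rel \<Rightarrow> 'a list rel" where
  "juxtapose R S = {(a @ c, b @ d) | a b c d. (a, b) \<in> R \<and> (c, d) \<in> S}"

abbreviation wf_inputs :: "factored \<Rightarrow> bool" where
  "wf_inputs F \<equiv> \<forall>G\<in>inputs F. pair_fin_digraph G"

lemma parcs_subset:
  "wf_inputs F \<Longrightarrow> parcs (graph_of F) \<subseteq> pverts (graph_of F) \<times> pverts (graph_of F)"
proof (induction F)
  case (Input G)
  then have "pair_wf_digraph G" by (auto simp: pair_fin_digraph_def)
  then show ?case by (auto simp: pair_wf_digraph_def)
qed (fastforce simp: cartesian_product_def tensor_product_def graph_union_def)+

lemma rel_Cartesian:
  "wf_inputs (Cartesian F H) \<Longrightarrow> rel m (Cartesian F H) =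
     (\<Union>(m1, m2)\<in>set (modes CartesianT m). juxtapose (rel m1 F) (rel m2 H))"
  using parcs_subset[of F] parcs_subset[of H]
  by (cases m) (fastforce simp: juxtapose_def cartesian_product_def)+

lemma rel_Tensor:
  "rel m (Tensor F H) = (\<Union>(m1, m2)\<in>set (modes TensorT m). juxtapose (rel m1 F) (rel m2 H))"
  by (cases m) (auto simp: juxtapose_def tensor_product_def)

lemma rel_Union:
  "rel m (Union F H) = (\<Union>(m1, m2)\<in>set (modes UnionT m). juxtapose (rel m1 F) (rel m2 H))"
  by (cases m) (auto simp: juxtapose_def graph_union_def)

definition tuple :: "(nat \<Rightarrow> token list) \<Rightarrow> nat list \<Rightarrow> nat list \<Rightarrow> bool" where
  "tuple \<tau> is v \<longleftrightarrow> list_all2 (\<lambda>i n. denotes (\<tau> i) n) is v"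

lemma tuple_simps [simp]:
  "tuple \<tau> [] v \<longleftrightarrow> v = []"
  "tuple \<tau> (i # is) v \<longleftrightarrow> (\<exists>n ns. v = n # ns \<and> denotes (\<tau> i) n \<and> tuple \<tau> is ns)"
  by (auto simp: tuple_def list_all2_Cons1)

lemma tuple_length: "tuple \<tau> is v \<Longrightarrow> length v = length is"
  by (auto simp: tuple_def dest: list_all2_lengthD)

lemma tuple_append:
  "length v = length is \<Longrightarrow> tuple \<tau> (is @ js) (v @ w) \<longleftrightarrow> tuple \<tau> is v \<and> tuple \<tau> js w"
  by (simp add: tuple_def list_all2_append)

lemma tuple_cong: "(\<And>i. i \<in> set is \<Longrightarrow> \<tau> i = \<tau>' i) \<Longrightarrow> tuple \<tau> is v \<longleftrightarrow> tuple \<tau>' is v"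
  by (induction "is" arbitrary: v) auto

lemma tuple_unique: "tuple \<tau> is v \<Longrightarrow> tuple \<tau> is w \<Longrightarrow> v = w"
  by (induction "is" arbitrary: v w) (auto dest: denotes_unique)

definition unchanged :: "nat set \<Rightarrow> (nat \<Rightarrow> token list) \<Rightarrow> (nat \<Rightarrow> token list) \<Rightarrow> bool" where
  "unchanged X \<tau> \<tau>' \<longleftrightarrow> (\<forall>i. i \<notin> X \<longrightarrow> \<tau>' i = \<tau> i)"

lemma unchanged_trans:
  "unchanged X \<tau> \<tau>1 \<Longrightarrow> unchanged Y \<tau>1 \<tau>2 \<Longrightarrow> X \<union> Y \<subseteq> Z \<Longrightarrow> unchanged Z \<tau> \<tau>2"
  unfolding unchanged_def by (metis UnI1 UnI2 subsetD)

definition registers :: "nat list \<Rightarrow> bool" where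
  "registers is \<longleftrightarrow> distinct is \<and> set is \<inter> {0, 1, 2} = {}"

abbreviation result ::
  "nat list \<Rightarrow> token list \<Rightarrow> (nat \<Rightarrow> token list) \<Rightarrow> (nat \<Rightarrow> token list) \<Rightarrow> bool" where
  "result is r \<tau> \<tau>' \<equiv> \<tau>' 0 = r \<and> unchanged ({0, 1, 2} \<union> set is) \<tau> \<tau>'"

text \<open>
  The registers \<open>is\<close> point to a tuple \<open>u\<close> before the run and to \<open>v\<close> after it; registers \<open>1\<close> and \<open>2\<close>
  are scratch.
\<close>

definition implements ::
  "token_action prog \<Rightarrow> nat list \<Rightarrow> token list \<Rightarrow> nat list rel \<Rightarrow> bool" where
  "implements p is ts R \<longleftrightarrow> (\<forall>\<tau> r. \<tau> 0 = ts @ r \<longrightarrow>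
     (\<forall>\<tau>'. (\<tau>, \<tau>') \<in> tsem p \<longrightarrow> result is r \<tau> \<tau>' \<and>
        (\<exists>u v. (u, v) \<in> R \<and> tuple \<tau> is u \<and> tuple \<tau>' is v)) \<and>
     (\<forall>u v. (u, v) \<in> R \<longrightarrow> tuple \<tau> is u \<longrightarrow>
        (\<exists>\<tau>'. (\<tau>, \<tau>') \<in> tsem p \<and> result is r \<tau> \<tau>' \<and> tuple \<tau>' is v)))"

lemma implementsI:
  assumes "\<And>\<tau> r \<tau>'. \<tau> 0 = ts @ r \<Longrightarrow> (\<tau>, \<tau>') \<in> tsem p \<Longrightarrow>
      result is r \<tau> \<tau>' \<and> (\<exists>u v. (u, v) \<in> R \<and> tuple \<tau> is u \<and> tuple \<tau>' is v)"
    and "\<And>\<tau> r u v. \<tau> 0 = ts @ r \<Longrightarrow> (u, v) \<in> R \<Longrightarrow> tuple \<tau> is u \<Longrightarrow>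
      \<exists>\<tau>'. (\<tau>, \<tau>') \<in> tsem p \<and> result is r \<tau> \<tau>' \<and> tuple \<tau>' is v"
  shows "implements p is ts R"
  unfolding implements_def using assms by blast

lemma implements_sound:
  assumes "implements p is ts R" "\<tau> 0 = ts @ r" "(\<tau>, \<tau>') \<in> tsem p"
  obtains u v where "result is r \<tau> \<tau>'" "(u, v) \<in> R" "tuple \<tau> is u" "tuple \<tau>' is v"
  using assms unfolding implements_def by blast

lemma implements_complete:
  assumes "implements p is ts R" "\<tau> 0 = ts @ r" "(u, v) \<in> R" "tuple \<tau> is u"
  obtains \<tau>' where "(\<tau>, \<tau>') \<in> tsem p" "result is r \<tau> \<tau>'" "tuple \<tau>' is v"
  using assms unfolding implements_def by blast

lemma implements_Seq:
  assumes p: "implements p is ts R" and q: "implements q js ts' S" and regs: "registers (is @ js)"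
  shows "implements (Seq p q) (is @ js) (ts @ ts') {(a @ c, b @ d) | a b c d.
    (a, b) \<in> R \<and> (c, d) \<in> S \<and> length a = length is}" (is "implements _ _ _ ?R")
proof (rule implementsI)
  have disj: "\<And>i. i \<in> set is \<Longrightarrow> i \<notin> {0, 1, 2} \<union> set js" "\<And>i. i \<in> set js \<Longrightarrow> i \<notin> {0, 1, 2} \<union> set is"
    using regs by (auto simp: registers_def)
  {
    fix \<tau> \<tau>' r
    assume \<tau>: "\<tau> 0 = (ts @ ts') @ r" and "(\<tau>, \<tau>') \<in> tsem (Seq p q)"
    then obtain \<tau>1 where 1: "(\<tau>, \<tau>1) \<in> tsem p" "(\<tau>1, \<tau>') \<in> tsem q" by auto
    obtain a b where ab: "result is (ts' @ r) \<tau> \<tau>1" "(a, b) \<in> R" "tuple \<tau> is a" "tuple \<tau>1 is b"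
      using implements_sound[OF p _ 1(1), of "ts' @ r"] \<tau> by auto
    obtain c d where cd: "result js r \<tau>1 \<tau>'" "(c, d) \<in> S" "tuple \<tau>1 js c" "tuple \<tau>' js d"
      using implements_sound[OF q _ 1(2), of r] ab(1) by auto
    have "tuple \<tau>' is b"
      using ab(4) cd(1) disj(1) tuple_cong[of "is" \<tau>' \<tau>1 b] unfolding unchanged_def by blast
    moreover have "tuple \<tau> js c"
      using cd(3) ab(1) disj(2) tuple_cong[of js \<tau>1 \<tau> c] unfolding unchanged_def by blast
    ultimately have "tuple \<tau> (is @ js) (a @ c)" "tuple \<tau>' (is @ js) (b @ d)"
      using ab cd tuple_length by (auto simp: tuple_append)
    moreover have "(a @ c, b @ d) \<in> ?R" using ab cd tuple_length by blast
    moreover have "result (is @ js) r \<tau> \<tau>'"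
      using ab(1) cd(1) by (auto intro: unchanged_trans)
    ultimately show "result (is @ js) r \<tau> \<tau>' \<and>
        (\<exists>u v. (u, v) \<in> ?R \<and> tuple \<tau> (is @ js) u \<and> tuple \<tau>' (is @ js) v)" by blast
  next
    fix \<tau> r u v
    assume \<tau>: "\<tau> 0 = (ts @ ts') @ r" and "(u, v) \<in> ?R" and u: "tuple \<tau> (is @ js) u"
    then obtain a b c d where abcd: "u = a @ c" "v = b @ d" "(a, b) \<in> R" "(c, d) \<in> S"
      "length a = length is" by blast
    with u have t: "tuple \<tau> is a" "tuple \<tau> js c" by (auto simp: tuple_append)
    obtain \<tau>1 where 1: "(\<tau>, \<tau>1) \<in> tsem p" "result is (ts' @ r) \<tau> \<tau>1" "tuple \<tau>1 is b"
      using implements_complete[OF p _ abcd(3) t(1), of "ts' @ r"] \<tau> by auto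
    have "tuple \<tau>1 js c"
      using t(2) 1(2) disj(2) tuple_cong[of js \<tau>1 \<tau> c] unfolding unchanged_def by blast
    then obtain \<tau>' where 2: "(\<tau>1, \<tau>') \<in> tsem q" "result js r \<tau>1 \<tau>'" "tuple \<tau>' js d"
      using implements_complete[OF q _ abcd(4), of \<tau>1 r] 1(2) by auto
    have "tuple \<tau>' is b"
      using 1(3) 2(2) disj(1) tuple_cong[of "is" \<tau>' \<tau>1 b] unfolding unchanged_def by blast
    then have "tuple \<tau>' (is @ js) v"
      using 1 2 abcd tuple_length by (auto simp: tuple_append)
    moreover have "result (is @ js) r \<tau> \<tau>'"
      using 1(2) 2(2) by (auto intro: unchanged_trans)
    moreover have "(\<tau>, \<tau>') \<in> tsem (Seq p q)" using 1 2 by auto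
    ultimately show "\<exists>\<tau>'. (\<tau>, \<tau>') \<in> tsem (Seq p q) \<and> result (is @ js) r \<tau> \<tau>' \<and> tuple \<tau>' (is @ js) v"
      by blast
  }
qed

lemma implements_tok:
  assumes p: "implements p is ts R" and regs: "registers is"
  shows "implements (Seq (tok t) p) is (t # ts) R"
proof (rule implementsI)
  have cong: "tuple (\<tau>(0 := r)) is u \<longleftrightarrow> tuple \<tau> is u" for \<tau> r u
    using regs by (intro tuple_cong) (auto simp: registers_def)
  have res: "result is r (\<tau>(0 := r')) \<tau>' \<longleftrightarrow> result is r \<tau> \<tau>'" for r r' \<tau> \<tau>'
    by (auto simp: unchanged_def)
  {
    fix \<tau> \<tau>' r
    assume \<tau>: "\<tau> 0 = (t # ts) @ r" and "(\<tau>, \<tau>') \<in> tsem (Seq (tok t) p)"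
    then have "(\<tau>(0 := ts @ r), \<tau>') \<in> tsem p" by auto
    then obtain u v where "result is r (\<tau>(0 := ts @ r)) \<tau>'" "(u, v) \<in> R"
      "tuple (\<tau>(0 := ts @ r)) is u" "tuple \<tau>' is v"
      using implements_sound[OF p] by (metis fun_upd_same)
    then show "result is r \<tau> \<tau>' \<and> (\<exists>u v. (u, v) \<in> R \<and> tuple \<tau> is u \<and> tuple \<tau>' is v)"
      unfolding cong res by blast
  next
    fix \<tau> r u v
    assume \<tau>: "\<tau> 0 = (t # ts) @ r" and uv: "(u, v) \<in> R" "tuple \<tau> is u"
    obtain \<tau>' where "(\<tau>(0 := ts @ r), \<tau>') \<in> tsem p" "result is r (\<tau>(0 := ts @ r)) \<tau>'" "tuple \<tau>' is v"
      using implements_complete[OF p _ uv(1), of "\<tau>(0 := ts @ r)" r] uv(2) cong by auto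
    moreover from this have "(\<tau>, \<tau>') \<in> tsem (Seq (tok t) p)" using \<tau> by auto
    ultimately show "\<exists>\<tau>'. (\<tau>, \<tau>') \<in> tsem (Seq (tok t) p) \<and> result is r \<tau> \<tau>' \<and> tuple \<tau>' is v"
      unfolding res by blast
  }
qed

lemma implements_restrict:
  assumes "implements p is ts R" "\<And>u v. length u = length is \<Longrightarrow> (u, v) \<in> R \<longleftrightarrow> (u, v) \<in> R'"
  shows "implements p is ts R'"
proof (rule implementsI)
  fix \<tau> \<tau>' r assume "\<tau> 0 = ts @ r" "(\<tau>, \<tau>') \<in> tsem p"
  then obtain u v where "result is r \<tau> \<tau>'" "(u, v) \<in> R" "tuple \<tau> is u" "tuple \<tau>' is v"
    by (rule implements_sound[OF assms(1)])
  then show "result is r \<tau> \<tau>' \<and> (\<exists>u v. (u, v) \<in> R' \<and> tuple \<tau> is u \<and> tuple \<tau>' is v)"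
    using assms(2) tuple_length by blast
next
  fix \<tau> r u v assume "\<tau> 0 = ts @ r" "(u, v) \<in> R'" "tuple \<tau> is u"
  then show "\<exists>\<tau>'. (\<tau>, \<tau>') \<in> tsem p \<and> result is r \<tau> \<tau>' \<and> tuple \<tau>' is v"
    using implements_complete[OF assms(1), of \<tau> r u v] assms(2)[of u v] tuple_length[of \<tau> "is" u] by blast
qed

lemma implements_stuck:
  assumes "\<And>\<tau> \<tau>' r. \<tau> 0 = ts @ r \<Longrightarrow> (\<tau>, \<tau>') \<notin> tsem p"
  shows "implements p is ts {}"
  using assms unfolding implements_def by blast

lemma implements_Choice:
  assumes p: "implements p is ts R" and q: "implements q is ts S"
  shows "implements (Choice p q) is ts (R \<union> S)"
proof (rule implementsI)
  fix \<tau> \<tau>' r assume \<tau>: "\<tau> 0 = ts @ r" and "(\<tau>, \<tau>') \<in> tsem (Choice p q)"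
  then consider "(\<tau>, \<tau>') \<in> tsem p" | "(\<tau>, \<tau>') \<in> tsem q" by auto
  then show "result is r \<tau> \<tau>' \<and> (\<exists>u v. (u, v) \<in> R \<union> S \<and> tuple \<tau> is u \<and> tuple \<tau>' is v)"
  proof cases
    case 1
    then show ?thesis using implements_sound[OF p, of \<tau>, OF \<tau>] by blast
  next
    case 2
    then show ?thesis using implements_sound[OF q, of \<tau>, OF \<tau>] by blast
  qed
next
  fix \<tau> r u v assume \<tau>: "\<tau> 0 = ts @ r" and "(u, v) \<in> R \<union> S" and u: "tuple \<tau> is u"
  then consider "(u, v) \<in> R" | "(u, v) \<in> S" by blast
  then show "\<exists>\<tau>'. (\<tau>, \<tau>') \<in> tsem (Choice p q) \<and> result is r \<tau> \<tau>' \<and> tuple \<tau>' is v"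
  proof cases
    case 1
    then show ?thesis using implements_complete[OF p, of \<tau>, OF \<tau> _ u] by (metis UnI1 sem.simps(4))
  next
    case 2
    then show ?thesis using implements_complete[OF q, of \<tau>, OF \<tau> _ u] by (metis UnI2 sem.simps(4))
  qed
qed

lemma implements_choices:
  "(\<And>a. a \<in> set as \<Longrightarrow> implements (f a) is ts (R a)) \<Longrightarrow>
     implements (choices (map f as)) is ts (\<Union>a\<in>set as. R a)"
proof (induction as)
  case Nil
  then show ?case by (auto simp: choices_def intro: implements_stuck)
next
  case (Cons a as)
  then have "implements (Choice (f a) (choices (map f as))) is ts (R a \<union> (\<Union>a\<in>set as. R a))"
    by (intro implements_Choice) auto
  then show ?case by (simp add: choices_def)
qed

fun leaf :: "mode \<Rightarrow> nat list \<Rightarrow> token_action prog" where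
  "leaf Skip [] = seqs [tok InputT, skip_list, skip_list]"
| "leaf Vertex [i] = seqs [tok InputT, Star skip_number, match i, skip_list, skip_list]"
| "leaf Arc [i] =
     seqs [tok InputT, skip_list, Star (Seq skip_number skip_number), match i, copy i 0, skip_list]"
| "leaf _ _ = Fail"

lemma tsem_leaf_Skip:
  assumes "\<tau> 0 = InputT # list_tokens ns @ list_tokens ns' @ r"
  shows "(\<tau>, \<tau>') \<in> tsem (leaf Skip []) \<longleftrightarrow> \<tau>' = \<tau>(0 := r)"
proof -
  have "(\<tau>, \<tau>') \<in> tsem (leaf Skip []) \<longleftrightarrow> (\<exists>\<rho>. (\<tau>(0 := list_tokens ns @ list_tokens ns' @ r), \<rho>) \<in> tsem skip_list \<and>
    (\<rho>, \<tau>') \<in> tsem skip_list)"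
    using assms by (auto simp: relcomp_unfold)
  also have "\<dots> \<longleftrightarrow> \<tau>' = \<tau>(0 := r)"
    using skip_list_exact[of _ ns "list_tokens ns' @ r"] skip_list_exact[of _ ns' r] by simp
  finally show ?thesis .
qed

lemma tsem_leaf_Vertex:
  assumes \<tau>: "\<tau> 0 = InputT # list_tokens ns @ list_tokens ns' @ r" and i: "2 < i"
  shows "(\<tau>, \<tau>') \<in> tsem (leaf Vertex [i]) \<longleftrightarrow> (\<exists>bs n cs r'. ns = bs @ n # cs \<and>
    \<tau> i = number_tokens n @ r' \<and> \<tau>' = \<tau>(1 := list_tokens cs @ list_tokens ns' @ r, 2 := r', 0 := r))"
    (is "?L \<longleftrightarrow> ?R")
proof -
  let ?r = "list_tokens ns' @ r"
  let ?\<tau> = "\<tau>(0 := list_tokens ns @ ?r)"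
  have L: "?L \<longleftrightarrow> (\<exists>\<rho>1 \<rho>2. (?\<tau>, \<rho>1) \<in> (tsem skip_number)\<^sup>* \<and> (\<rho>1, \<rho>2) \<in> tsem (match i) \<and>
      (\<rho>2, \<tau>') \<in> tsem skip_list O tsem skip_list)"
    using \<tau> by (auto simp: relcomp_unfold)
  have star: "(?\<tau>, \<rho>) \<in> (tsem skip_number)\<^sup>* \<longleftrightarrow> (\<exists>bs cs. ns = bs @ cs \<and> \<rho> = \<tau>(0 := list_tokens cs @ ?r))" for \<rho>
    using tsem_skip_numbers[of ?\<tau> ns ?r \<rho>] by simp
  have fin: "(\<rho>, \<tau>') \<in> tsem skip_list O tsem skip_list \<longleftrightarrow> \<tau>' = \<rho>(0 := r)"
    if "\<rho> 0 = list_tokens cs @ ?r" for \<rho> cs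
    using skip_list_exact[of \<rho> cs ?r] skip_list_exact[of _ ns' r] that by (simp add: relcomp_unfold)
  show ?thesis
  proof
    assume ?L
    then obtain bs cs \<rho>1 \<rho>2 where bs: "ns = bs @ cs" "\<rho>1 = \<tau>(0 := list_tokens cs @ ?r)"
      and m: "(\<rho>1, \<rho>2) \<in> tsem (match i)" and f: "(\<rho>2, \<tau>') \<in> tsem skip_list O tsem skip_list"
      unfolding L star by blast
    show ?R
    proof (cases cs)
      case Nil
      then have "\<rho>1 0 = End # ?r" using bs by (simp add: list_tokens_def)
      then show ?thesis using m match_End[OF i] by blast
    next
      case (Cons n cs')
      then have "\<rho>1 0 = number_tokens n @ list_tokens cs' @ ?r" using bs by (simp add: list_tokens_def)
      then obtain r' where r': "\<rho>1 i = number_tokens n @ r'"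
        "\<rho>2 = \<rho>1(1 := list_tokens cs' @ ?r, 2 := r', 0 := list_tokens cs' @ ?r)"
        using m match_exact[of \<rho>1 n _ i] i by blast
      then have "\<tau>' = \<rho>2(0 := r)" using f fin[of \<rho>2 cs'] by simp
      then show ?thesis using r' bs Cons i
        by (intro exI[of _ bs] exI[of _ n] exI[of _ cs'] exI[of _ r']) (auto simp: fun_eq_iff)
    qed
  next
    assume ?R
    then obtain bs n cs r' where R: "ns = bs @ n # cs" "\<tau> i = number_tokens n @ r'"
      "\<tau>' = \<tau>(1 := list_tokens cs @ ?r, 2 := r', 0 := r)" by auto
    let ?\<rho>1 = "\<tau>(0 := list_tokens (n # cs) @ ?r)"
    let ?\<rho>2 = "?\<rho>1(1 := list_tokens cs @ ?r, 2 := r', 0 := list_tokens cs @ ?r)"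
    have "(?\<tau>, ?\<rho>1) \<in> (tsem skip_number)\<^sup>*" unfolding star using R(1) by blast
    moreover have "(?\<rho>1, ?\<rho>2) \<in> tsem (match i)"
      using match_exact[of ?\<rho>1 n "list_tokens cs @ ?r" i] i R(2) by (simp add: list_tokens_def)
    moreover have "(?\<rho>2, \<tau>') \<in> tsem skip_list O tsem skip_list"
    proof -
      have "\<tau>' = ?\<rho>2(0 := r)" using R(3) by (simp add: fun_eq_iff)
      then show ?thesis using fin[of ?\<rho>2 cs] by simp
    qed
    ultimately show ?L unfolding L by blast
  qed
qed

definition flatten :: "(nat \<times> nat) list \<Rightarrow> nat list" where
  "flatten es = concat (map (\<lambda>(u, v). [u, v]) es)"

lemma tsem_skip_pairs:
  assumes "\<tau> 0 = list_tokens (flatten es) @ r"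
  shows "(\<tau>, \<tau>') \<in> (tsem (Seq skip_number skip_number))\<^sup>* \<longleftrightarrow>
     (\<exists>bs cs. es = bs @ cs \<and> \<tau>' = \<tau>(0 := list_tokens (flatten cs) @ r))"
proof -
  let ?f = "\<lambda>(u, v). number_tokens u @ number_tokens v"
  have eq: "list_tokens (flatten es) @ r = concat (map ?f es) @ End # r" for es
    by (induction es) (auto simp: list_tokens_def flatten_def)
  have "(\<tau>, \<tau>') \<in> tsem (Seq skip_number skip_number) \<longleftrightarrow> \<tau>' = \<tau>(0 := r)"
    if "\<tau> 0 = ?f e @ r" for \<tau> \<tau>' e r
    using that skip_number_exact[of \<tau> "fst e"] skip_number_exact[of _ "snd e"]
    by (auto simp: split_beta relcomp_unfold)
  then show ?thesis
    using star_items[of ?f "tsem (Seq skip_number skip_number)" \<tau> es r \<tau>'] assms skip_number_End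
    unfolding eq by (auto simp: relcomp_unfold)
qed

lemma tsem_leaf_Arc:
  assumes \<tau>: "\<tau> 0 = InputT # list_tokens ns @ list_tokens (flatten es) @ r" and i: "2 < i"
  shows "(\<tau>, \<tau>') \<in> tsem (leaf Arc [i]) \<longleftrightarrow> (\<exists>bs u v cs r' q. es = bs @ (u, v) # cs \<and>
    \<tau> i = number_tokens u @ r' \<and> q = number_tokens v @ list_tokens (flatten cs) @ r \<and>
    \<tau>' = \<tau>(1 := q, 2 := r', i := q, 0 := r))"
    (is "?L \<longleftrightarrow> ?R")
proof -
  let ?\<tau> = "\<tau>(0 := list_tokens (flatten es) @ r)"
  have "?L \<longleftrightarrow> (\<exists>\<rho>0 \<rho>1 \<rho>2. (\<tau>(0 := list_tokens ns @ list_tokens (flatten es) @ r), \<rho>0) \<in> tsem skip_list \<and>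
      (\<rho>0, \<rho>1) \<in> (tsem (Seq skip_number skip_number))\<^sup>* \<and> (\<rho>1, \<rho>2) \<in> tsem (match i) \<and>
      (\<rho>2(i := \<rho>2 0), \<tau>') \<in> tsem skip_list)"
    using \<tau> by (auto simp: relcomp_unfold)
  then have L: "?L \<longleftrightarrow> (\<exists>\<rho>1 \<rho>2. (?\<tau>, \<rho>1) \<in> (tsem (Seq skip_number skip_number))\<^sup>* \<and>
      (\<rho>1, \<rho>2) \<in> tsem (match i) \<and> (\<rho>2(i := \<rho>2 0), \<tau>') \<in> tsem skip_list)"
    using skip_list_exact[of "\<tau>(0 := list_tokens ns @ list_tokens (flatten es) @ r)" ns] by simp
  have star: "(?\<tau>, \<rho>) \<in> (tsem (Seq skip_number skip_number))\<^sup>* \<longleftrightarrow>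
      (\<exists>bs cs. es = bs @ cs \<and> \<rho> = \<tau>(0 := list_tokens (flatten cs) @ r))" for \<rho>
    using tsem_skip_pairs[of ?\<tau> es r \<rho>] by simp
  have split: "list_tokens (flatten ((u, v) # cs)) @ r = number_tokens u @ number_tokens v @ list_tokens (flatten cs) @ r"
    "number_tokens v @ list_tokens (flatten cs) @ r = list_tokens (v # flatten cs) @ r" for u v cs
    by (auto simp: list_tokens_def flatten_def)
  show ?thesis
  proof
    assume ?L
    then obtain bs cs \<rho>1 \<rho>2 where bs: "es = bs @ cs" "\<rho>1 = \<tau>(0 := list_tokens (flatten cs) @ r)"
      and m: "(\<rho>1, \<rho>2) \<in> tsem (match i)" and f: "(\<rho>2(i := \<rho>2 0), \<tau>') \<in> tsem skip_list"
      unfolding L star by blast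
    show ?R
    proof (cases cs)
      case Nil
      then have "\<rho>1 0 = End # r" using bs by (simp add: list_tokens_def flatten_def)
      then show ?thesis using m match_End[OF i] by blast
    next
      case (Cons e cs')
      obtain u v where e: "e = (u, v)" by fastforce
      let ?q = "number_tokens v @ list_tokens (flatten cs') @ r"
      have "\<rho>1 0 = number_tokens u @ ?q" using bs Cons e split(1) by simp
      then obtain r' where r': "\<rho>1 i = number_tokens u @ r'" "\<rho>2 = \<rho>1(1 := ?q, 2 := r', 0 := ?q)"
        using m match_exact[of \<rho>1 u ?q i] i by blast
      then have "\<tau>' = (\<rho>2(i := \<rho>2 0))(0 := r)"
        using f skip_list_exact[of "\<rho>2(i := \<rho>2 0)" "v # flatten cs'" r] i split(2) by simp
      then show ?thesis using r' bs Cons e i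
        by (intro exI[of _ bs] exI[of _ u] exI[of _ v] exI[of _ cs'] exI[of _ r'] exI[of _ ?q])
          (auto simp: fun_eq_iff)
    qed
  next
    assume ?R
    then obtain bs u v cs r' q where R: "es = bs @ (u, v) # cs" "\<tau> i = number_tokens u @ r'"
      "q = number_tokens v @ list_tokens (flatten cs) @ r" "\<tau>' = \<tau>(1 := q, 2 := r', i := q, 0 := r)" by auto
    let ?\<rho>1 = "\<tau>(0 := list_tokens (flatten ((u, v) # cs)) @ r)"
    let ?\<rho>2 = "?\<rho>1(1 := q, 2 := r', 0 := q)"
    have "(?\<tau>, ?\<rho>1) \<in> (tsem (Seq skip_number skip_number))\<^sup>*" unfolding star using R(1) by blast
    moreover have "(?\<rho>1, ?\<rho>2) \<in> tsem (match i)"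
      using match_exact[of ?\<rho>1 u q i] i R(2,3) split(1) by simp
    moreover have "(?\<rho>2(i := ?\<rho>2 0), \<tau>') \<in> tsem skip_list"
    proof -
      have "(?\<rho>2(i := ?\<rho>2 0)) 0 = list_tokens (v # flatten cs) @ r" using i R(3) split(2) by simp
      moreover have "\<tau>' = (?\<rho>2(i := ?\<rho>2 0))(0 := r)" using R(4) i by (simp add: fun_eq_iff)
      ultimately show ?thesis using skip_list_exact by blast
    qed
    ultimately show ?L unfolding L by blast
  qed
qed

lemma set_vertex_list: "pair_fin_digraph G \<Longrightarrow> set (vertex_list G) = pverts G"
  by (simp add: vertex_list_def pair_fin_digraph_def pair_fin_digraph_axioms_def)

lemma set_arc_list: "pair_fin_digraph G \<Longrightarrow> set (arc_list G) = parcs G"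
proof -
  assume G: "pair_fin_digraph G"
  then have "pair_wf_digraph G" by (simp add: pair_fin_digraph_def)
  then show ?thesis by (auto simp: arc_list_def set_vertex_list[OF G] pair_wf_digraph_def)
qed

lemma leaf_correct:
  assumes G: "pair_fin_digraph G" and regs: "registers is"
  shows "implements (leaf m is) is (factored_tokens (Input G)) (rel m (Input G))"
proof -
  note leaf.simps [simp del]
  have empty: "implements (leaf m is) is ts R" if "leaf m is = Fail" "\<And>u v. (u, v) \<in> R \<Longrightarrow> length u \<noteq> length is" for ts R
    using that by (intro implements_restrict[OF implements_stuck]) auto
  have tokens: "factored_tokens (Input G) =
      InputT # list_tokens (vertex_list G) @ list_tokens (flatten (arc_list G))"
    by (simp add: flatten_def)
  show ?thesis
  proof (cases m)
    case Skip
    show ?thesis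
    proof (cases "is")
      case Nil
      then show ?thesis unfolding Skip tokens
        by (auto intro!: implementsI simp: tsem_leaf_Skip unchanged_def)
    next
      case (Cons i js)
      then show ?thesis unfolding Skip by (intro empty[unfolded Skip]) (auto simp: leaf.simps)
    qed
  next
    case Vertex
    show ?thesis
    proof (cases "\<exists>i. is = [i]")
      case True
      then obtain i where i: "is = [i]" "2 < i" using regs by (auto simp: registers_def)
      show ?thesis unfolding Vertex tokens i(1)
      proof (rule implementsI)
        fix \<tau> \<tau>' r
        assume \<tau>: "\<tau> 0 = (InputT # list_tokens (vertex_list G) @ list_tokens (flatten (arc_list G))) @ r"
          and "(\<tau>, \<tau>') \<in> tsem (leaf Vertex [i])"
        then obtain bs n cs r' q where n: "vertex_list G = bs @ n # cs" "\<tau> i = number_tokens n @ r'"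
          "\<tau>' = \<tau>(1 := q, 2 := r', 0 := r)"
          using tsem_leaf_Vertex[of \<tau> _ _ r i \<tau>'] i(2) by auto
        then have "n \<in> pverts G" using set_vertex_list[OF G] by (metis in_set_conv_decomp)
        then show "result [i] r \<tau> \<tau>' \<and>
            (\<exists>u v. (u, v) \<in> rel Vertex (Input G) \<and> tuple \<tau> [i] u \<and> tuple \<tau>' [i] v)"
          using n i(2) by (auto simp: unchanged_def denotes_def intro!: exI[of _ "[n]"])
      next
        fix \<tau> r u v
        assume \<tau>: "\<tau> 0 = (InputT # list_tokens (vertex_list G) @ list_tokens (flatten (arc_list G))) @ r"
          and uv: "(u, v) \<in> rel Vertex (Input G)" "tuple \<tau> [i] u"
        then obtain n r' where n: "u = [n]" "v = [n]" "n \<in> pverts G" "\<tau> i = number_tokens n @ r'"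
          by (auto simp: denotes_def prefix_def)
        then obtain bs cs where bs: "vertex_list G = bs @ n # cs"
          using set_vertex_list[OF G] by (metis in_set_conv_decomp)
        define q where "q = list_tokens cs @ list_tokens (flatten (arc_list G)) @ r"
        have "(\<tau>, \<tau>(1 := q, 2 := r', 0 := r)) \<in> tsem (leaf Vertex [i])"
          unfolding q_def tsem_leaf_Vertex[of \<tau>, OF \<tau>[unfolded append_Cons append_assoc] i(2)]
          using bs n(4) by blast
        then show "\<exists>\<tau>'. (\<tau>, \<tau>') \<in> tsem (leaf Vertex [i]) \<and> result [i] r \<tau> \<tau>' \<and> tuple \<tau>' [i] v"
          using n i(2)
          by (intro exI[of _ "\<tau>(1 := q, 2 := r', 0 := r)"]) (auto simp: unchanged_def denotes_def)
      qed
    next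
      case False
      then have "leaf Vertex is = Fail" "length is \<noteq> 1"
        by (cases "is" rule: list.exhaust; cases "tl is"; auto simp: leaf.simps)+
      then show ?thesis unfolding Vertex by (intro empty[unfolded Vertex]) auto
    qed
  next
    case Arc
    show ?thesis
    proof (cases "\<exists>i. is = [i]")
      case True
      then obtain i where i: "is = [i]" "2 < i" using regs by (auto simp: registers_def)
      show ?thesis unfolding Arc tokens i(1)
      proof (rule implementsI)
        fix \<tau> \<tau>' r
        assume \<tau>: "\<tau> 0 = (InputT # list_tokens (vertex_list G) @ list_tokens (flatten (arc_list G))) @ r"
          and "(\<tau>, \<tau>') \<in> tsem (leaf Arc [i])"
        then obtain bs u v cs r' q where uv: "arc_list G = bs @ (u, v) # cs" "\<tau> i = number_tokens u @ r'"
          "\<tau>' = \<tau>(1 := number_tokens v @ q, 2 := r', i := number_tokens v @ q, 0 := r)"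
          using tsem_leaf_Arc[of \<tau> _ _ r i \<tau>'] i(2) by auto
        then have "(u, v) \<in> parcs G" using set_arc_list[OF G] by (metis in_set_conv_decomp)
        then show "result [i] r \<tau> \<tau>' \<and>
            (\<exists>u v. (u, v) \<in> rel Arc (Input G) \<and> tuple \<tau> [i] u \<and> tuple \<tau>' [i] v)"
          using uv i(2)
          by (intro conjI exI[of _ "[u]"] exI[of _ "[v]"]) (auto simp: unchanged_def denotes_def)
      next
        fix \<tau> r u v
        assume \<tau>: "\<tau> 0 = (InputT # list_tokens (vertex_list G) @ list_tokens (flatten (arc_list G))) @ r"
          and uv: "(u, v) \<in> rel Arc (Input G)" "tuple \<tau> [i] u"
        then obtain a b r' where ab: "u = [a]" "v = [b]" "(a, b) \<in> parcs G" "\<tau> i = number_tokens a @ r'"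
          by (auto simp: denotes_def prefix_def)
        then obtain bs cs where bs: "arc_list G = bs @ (a, b) # cs"
          using set_arc_list[OF G] by (metis in_set_conv_decomp)
        define q where "q = list_tokens (flatten cs) @ r"
        have "(\<tau>, \<tau>(1 := number_tokens b @ q, 2 := r', i := number_tokens b @ q, 0 := r))
            \<in> tsem (leaf Arc [i])"
          unfolding q_def tsem_leaf_Arc[of \<tau>, OF \<tau>[unfolded append_Cons append_assoc] i(2)]
          using bs ab(4) by blast
        then show "\<exists>\<tau>'. (\<tau>, \<tau>') \<in> tsem (leaf Arc [i]) \<and> result [i] r \<tau> \<tau>' \<and> tuple \<tau>' [i] v"
          using ab i(2)
          by (intro exI[of _ "\<tau>(1 := number_tokens b @ q, 2 := r', i := number_tokens b @ q, 0 := r)"])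
            (auto simp: unchanged_def denotes_def)
      qed
    next
      case False
      then have "leaf Arc is = Fail" "length is \<noteq> 1"
        by (cases "is" rule: list.exhaust; cases "tl is"; auto simp: leaf.simps)+
      then show ?thesis unfolding Arc by (intro empty[unfolded Arc]) auto
    qed
  qed
qed

lemma leaf_stuck: "t \<noteq> InputT \<Longrightarrow> implements (leaf m is) is (t # ts) {}"
  by (rule implements_stuck, cases "(m, is)" rule: leaf.cases) auto

definition branches :: "mode \<Rightarrow> nat \<Rightarrow> (token \<times> mode \<times> mode \<times> nat) list" where
  "branches m l = concat (map (\<lambda>t. map (\<lambda>((m1, m2), i). (t, m1, m2, i))
     (List.product (modes t m) [0..<Suc l])) [CartesianT, TensorT, UnionT])"

lemma set_branches:
  "(t, m1, m2, i) \<in> set (branches m l) \<longleftrightarrow>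
     t \<in> {CartesianT, TensorT, UnionT} \<and> (m1, m2) \<in> set (modes t m) \<and> i \<le> l"
proof -
  have "(t, m1, m2, i) \<in> (\<lambda>((m1, m2), i). (t', m1, m2, i)) ` (A \<times> B) \<longleftrightarrow>
      t = t' \<and> (m1, m2) \<in> A \<and> i \<in> B" for t' and A :: "(mode \<times> mode) set" and B :: "nat set"
    by (auto simp: image_def intro!: bexI[of _ "(m1, m2)"])
  then show ?thesis
    by (auto simp: branches_def less_Suc_eq_le simp del: modes.simps upt_Suc)
qed

fun check :: "nat \<Rightarrow> mode \<Rightarrow> nat list \<Rightarrow> token_action prog" where
  "check 0 m is = leaf m is"
| "check (Suc d) m is = Choice (leaf m is) (choices (map (\<lambda>(t, m1, m2, i).
     Seq (tok t) (Seq (check d m1 (take i is)) (check d m2 (drop i is)))) (branches m (length is))))"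

lemma branches_correct:
  assumes F: "\<And>m is. registers is \<Longrightarrow> implements (check d m is) is ts (rel m F)"
    and H: "\<And>m is. registers is \<Longrightarrow> implements (check d m is) is ts' (rel m H)"
    and t: "t \<in> {CartesianT, TensorT, UnionT}" and regs: "registers is"
  shows "implements (check (Suc d) m is) is (t # ts @ ts')
     (\<Union>(m1, m2)\<in>set (modes t m). juxtapose (rel m1 F) (rel m2 H))"
proof -
  let ?J = "\<lambda>m1 m2 i. {(a @ c, b @ d) | a b c d. (a, b) \<in> rel m1 F \<and> (c, d) \<in> rel m2 H \<and> length a = length (take i is)}"
  let ?f = "\<lambda>(t, m1, m2, i). Seq (tok t) (Seq (check d m1 (take i is)) (check d m2 (drop i is)))"
  let ?R = "\<lambda>(t', m1, m2, i). if t' = t then ?J m1 m2 i else {}"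
  have "implements (?f a) is (t # ts @ ts') (?R a)" for a
  proof -
    obtain t' m1 m2 i where a: "a = (t', m1, m2, i)" by (metis prod.exhaust)
    show ?thesis
    proof (cases "t' = t")
      case True
      have "registers (take i is @ drop i is)" using regs by simp
      moreover from this have "registers (take i is)" "registers (drop i is)"
        using set_take_subset[of i "is"] set_drop_subset[of i "is"] by (auto simp: registers_def)
      ultimately have "implements (Seq (check d m1 (take i is)) (check d m2 (drop i is)))
          (take i is @ drop i is) (ts @ ts') (?J m1 m2 i)"
        using F H by (intro implements_Seq) auto
      then show ?thesis using implements_tok[OF _ regs] a True by simp
    next
      case False
      then show ?thesis using a by (auto intro!: implements_stuck)
    qed
  qed
  then have "implements (choices (map ?f (branches m (length is)))) is (t # ts @ ts')
      (\<Union>a\<in>set (branches m (length is)). ?R a)"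
    by (intro implements_choices)
  moreover have "implements (leaf m is) is (t # ts @ ts') {}"
    using t by (intro leaf_stuck) auto
  ultimately have "implements (check (Suc d) m is) is (t # ts @ ts')
      ({} \<union> (\<Union>a\<in>set (branches m (length is)). ?R a))"
    unfolding check.simps by (intro implements_Choice)
  then show ?thesis
  proof (rule implements_restrict)
    fix u v :: "nat list" assume u: "length u = length is"
    have "(u, v) \<in> (\<Union>a\<in>set (branches m (length is)). ?R a) \<longleftrightarrow>
      (\<exists>m1 m2 i. (t, m1, m2, i) \<in> set (branches m (length is)) \<and> (u, v) \<in> ?J m1 m2 i)"
    proof
      assume "(u, v) \<in> (\<Union>a\<in>set (branches m (length is)). ?R a)"
      then obtain a where "a \<in> set (branches m (length is))" "(u, v) \<in> ?R a" by blast
      moreover obtain t' m1 m2 i where "a = (t', m1, m2, i)" by (metis prod.exhaust)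
      ultimately have a: "(t', m1, m2, i) \<in> set (branches m (length is))" "(u, v) \<in> ?R (t', m1, m2, i)"
        by blast+
      then have "t' = t" "(u, v) \<in> ?J m1 m2 i" by (simp_all split: if_splits)
      with a(1) show "\<exists>m1 m2 i. (t, m1, m2, i) \<in> set (branches m (length is)) \<and> (u, v) \<in> ?J m1 m2 i"
        by blast
    next
      assume "\<exists>m1 m2 i. (t, m1, m2, i) \<in> set (branches m (length is)) \<and> (u, v) \<in> ?J m1 m2 i"
      then obtain m1 m2 i where "(t, m1, m2, i) \<in> set (branches m (length is))" "(u, v) \<in> ?J m1 m2 i"
        by blast
      then show "(u, v) \<in> (\<Union>a\<in>set (branches m (length is)). ?R a)"
        by (intro UN_I[of "(t, m1, m2, i)"]) simp_all
    qed
    also have "\<dots> \<longleftrightarrow> (\<exists>(m1, m2)\<in>set (modes t m). \<exists>i\<le>length is. (u, v) \<in> ?J m1 m2 i)"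
      unfolding set_branches using t by blast
    also have "\<dots> \<longleftrightarrow> (\<exists>(m1, m2)\<in>set (modes t m). (u, v) \<in> juxtapose (rel m1 F) (rel m2 H))"
    proof -
      have "(\<exists>i\<le>length is. (u, v) \<in> ?J m1 m2 i) \<longleftrightarrow> (u, v) \<in> juxtapose (rel m1 F) (rel m2 H)" for m1 m2
      proof
        assume "(u, v) \<in> juxtapose (rel m1 F) (rel m2 H)"
        then obtain a b c d where "u = a @ c" "v = b @ d" "(a, b) \<in> rel m1 F" "(c, d) \<in> rel m2 H"
          by (auto simp: juxtapose_def)
        then show "\<exists>i\<le>length is. (u, v) \<in> ?J m1 m2 i"
          using u by (intro exI[of _ "length a"]) auto
      qed (auto simp: juxtapose_def)
      then show ?thesis by simp
    qed
    finally show "(u, v) \<in> {} \<union> (\<Union>a\<in>set (branches m (length is)). ?R a) \<longleftrightarrow>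
        (u, v) \<in> (\<Union>(m1, m2)\<in>set (modes t m). juxtapose (rel m1 F) (rel m2 H))"
      by auto
  qed
qed

lemma check_correct:
  "wf_inputs F \<Longrightarrow> num_operations F \<le> d \<Longrightarrow> registers is \<Longrightarrow>
     implements (check d m is) is (factored_tokens F) (rel m F)"
proof (induction d arbitrary: F m "is")
  case 0
  then obtain G where "F = Input G" by (cases F) auto
  with 0 leaf_correct[of G "is" m] show ?case by simp
next
  case (Suc d)
  have IH: "implements (check d m is) is (factored_tokens H) (rel m H)"
    if "wf_inputs H" "num_operations H \<le> d" "registers is" for H m "is"
    using Suc.IH that by blast
  show ?case
  proof (cases F)
    case (Input G)
    have "implements (choices (map (\<lambda>(t, m1, m2, i).
        Seq (tok t) (Seq (check d m1 (take i is)) (check d m2 (drop i is)))) (branches m (length is))))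
        is (factored_tokens F) {}"
      using Input by (intro implements_stuck) (auto simp: sem_choices set_branches)
    then have "implements (check (Suc d) m is) is (factored_tokens F) (rel m F \<union> {})"
      unfolding check.simps using leaf_correct[of G "is" m] Suc.prems Input
      by (intro implements_Choice) auto
    then show ?thesis by simp
  next
    case (Cartesian F1 F2)
    then have "implements (check (Suc d) m is) is (CartesianT # factored_tokens F1 @ factored_tokens F2)
        (\<Union>(m1, m2)\<in>set (modes CartesianT m). juxtapose (rel m1 F1) (rel m2 F2))"
      using Suc.prems by (intro branches_correct IH) auto
    then show ?thesis using Cartesian rel_Cartesian Suc.prems(1) by simp
  next
    case (Tensor F1 F2)
    then have "implements (check (Suc d) m is) is (TensorT # factored_tokens F1 @ factored_tokens F2)
        (\<Union>(m1, m2)\<in>set (modes TensorT m). juxtapose (rel m1 F1) (rel m2 F2))"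
      using Suc.prems by (intro branches_correct IH) auto
    then show ?thesis using Tensor rel_Tensor by simp
  next
    case (Union F1 F2)
    then have "implements (check (Suc d) m is) is (UnionT # factored_tokens F1 @ factored_tokens F2)
        (\<Union>(m1, m2)\<in>set (modes UnionT m). juxtapose (rel m1 F1) (rel m2 F2))"
      using Suc.prems by (intro branches_correct IH) auto
    then show ?thesis using Union rel_Union by simp
  qed
qed


section \<open>Searching a path\<close>

fun load :: "nat list \<Rightarrow> token_action prog" where
  "load [] = tok End"
| "load (i # is) = Seq (copy i 0) (Seq skip_number (load is))"

fun verify :: "nat list \<Rightarrow> token_action prog" where
  "verify [] = tok End"
| "verify (i # is) = Seq (match i) (verify is)"

lemma list_tokens_Nil: "list_tokens [] @ r = End # r"
  by (simp add: list_tokens_def)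

lemma list_tokens_Cons: "list_tokens (n # ns) @ r = number_tokens n @ list_tokens ns @ r"
  by (simp add: list_tokens_def)

lemma list_tokens_End: "list_tokens ns @ r = End # r' \<longleftrightarrow> ns = [] \<and> r = r'"
  by (simp add: list_tokens_def concat_number_tokens_End)

lemma load_sound:
  "\<tau> 0 = list_tokens ns @ r \<Longrightarrow> distinct is \<Longrightarrow> 0 \<notin> set is \<Longrightarrow> (\<tau>, \<tau>') \<in> tsem (load is) \<Longrightarrow>
     tuple \<tau>' is ns \<and> \<tau>' 0 = r \<and> unchanged ({0} \<union> set is) \<tau> \<tau>'"
proof (induction "is" arbitrary: ns \<tau>)
  case Nil
  then show ?case by (auto simp: list_tokens_End unchanged_def)
next
  case (Cons i js)
  let ?\<tau> = "\<tau>(i := \<tau> 0)"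
  from Cons.prems(4) obtain \<tau>2 where 2: "(?\<tau>, \<tau>2) \<in> tsem skip_number" "(\<tau>2, \<tau>') \<in> tsem (load js)"
    by auto
  have i: "i \<noteq> 0" "i \<notin> set js" using Cons.prems by auto
  show ?case
  proof (cases ns)
    case Nil
    then have "?\<tau> 0 = End # r" using Cons.prems(1) i by (simp add: list_tokens_Nil)
    then show ?thesis using 2(1) skip_number_End by blast
  next
    case (Cons n ns')
    then have \<tau>: "\<tau> 0 = number_tokens n @ list_tokens ns' @ r" using Cons.prems(1) by (simp only: list_tokens_Cons)
    then have \<tau>2: "\<tau>2 = ?\<tau>(0 := list_tokens ns' @ r)"
      using 2(1) skip_number_exact[of ?\<tau> n] i by simp
    then have "\<tau>2 0 = list_tokens ns' @ r" by simp
    then have IH: "tuple \<tau>' js ns'" "\<tau>' 0 = r" "unchanged ({0} \<union> set js) \<tau>2 \<tau>'"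
      using Cons.IH[of \<tau>2 ns', OF _ _ _ 2(2)] Cons.prems(2,3) by simp_all
    from IH(3) have "\<tau>' i = number_tokens n @ list_tokens ns' @ r"
      using \<tau>2 \<tau> i by (simp add: unchanged_def)
    then show ?thesis using IH Cons \<tau>2 by (auto simp: denotes_def unchanged_def)
  qed
qed

lemma load_complete:
  "\<tau> 0 = list_tokens ns @ r \<Longrightarrow> 0 \<notin> set is \<Longrightarrow> length ns = length is \<Longrightarrow>
     \<exists>\<tau>'. (\<tau>, \<tau>') \<in> tsem (load is)"
proof (induction "is" arbitrary: ns \<tau>)
  case Nil
  then show ?case by (auto simp: list_tokens_Nil)
next
  case (Cons i js)
  then obtain n ns' where ns: "ns = n # ns'" by (cases ns) auto
  let ?\<tau> = "\<tau>(i := \<tau> 0)"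
  let ?\<tau>2 = "?\<tau>(0 := list_tokens ns' @ r)"
  have "?\<tau> 0 = number_tokens n @ list_tokens ns' @ r" using Cons.prems ns by (simp add: list_tokens_Cons)
  then have "(?\<tau>, ?\<tau>2) \<in> tsem skip_number" using skip_number_exact by blast
  moreover have "?\<tau>2 0 = list_tokens ns' @ r" by simp
  from Cons.IH[of ?\<tau>2 ns', OF this] Cons.prems(2,3) ns
  obtain \<tau>' where "(?\<tau>2, \<tau>') \<in> tsem (load js)" by (metis insertI2 list.set(2) length_Cons nat.inject)
  moreover have "(\<tau>, ?\<tau>) \<in> tsem (copy i 0)" by auto
  ultimately have "(\<tau>, \<tau>') \<in> tsem (load (i # js))"
    unfolding load.simps sem.simps(3) by (intro relcompI)
  then show ?case by blast
qed

lemma verify_iff: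
  "\<tau> 0 = list_tokens ns @ r \<Longrightarrow> set is \<inter> {0, 1, 2} = {} \<Longrightarrow>
     (\<exists>\<tau>'. (\<tau>, \<tau>') \<in> tsem (verify is)) \<longleftrightarrow> tuple \<tau> is ns"
proof (induction "is" arbitrary: ns \<tau>)
  case Nil
  then show ?case by (auto simp: list_tokens_End)
next
  case (Cons i js)
  have i: "2 < i" using Cons.prems by auto
  show ?case
  proof (cases ns)
    case Nil
    then have "\<tau> 0 = End # r" using Cons.prems(1) by (simp add: list_tokens_Nil)
    then show ?thesis using Nil match_End[OF i, of \<tau>] by auto
  next
    case (Cons n ns')
    let ?\<tau> = "\<lambda>r'. \<tau>(1 := list_tokens ns' @ r, 2 := r', 0 := list_tokens ns' @ r)"
    have \<tau>: "\<tau> 0 = number_tokens n @ list_tokens ns' @ r"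
      using Cons.prems(1) Cons by (simp only: list_tokens_Cons)
    have "(\<exists>\<tau>'. (\<tau>, \<tau>') \<in> tsem (verify (i # js))) \<longleftrightarrow>
        (\<exists>\<rho>. (\<tau>, \<rho>) \<in> tsem (match i) \<and> (\<exists>\<tau>'. (\<rho>, \<tau>') \<in> tsem (verify js)))"
      by auto
    also have "\<dots> \<longleftrightarrow> (\<exists>r'. \<tau> i = number_tokens n @ r' \<and> (\<exists>\<tau>'. (?\<tau> r', \<tau>') \<in> tsem (verify js)))"
      unfolding match_exact[of \<tau>, OF \<tau> i] by blast
    also have "\<dots> \<longleftrightarrow> (\<exists>r'. \<tau> i = number_tokens n @ r' \<and> tuple \<tau> js ns')"
    proof -
      have "(\<exists>\<tau>'. (?\<tau> r', \<tau>') \<in> tsem (verify js)) \<longleftrightarrow> tuple (?\<tau> r') js ns'" for r'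
        using Cons.prems(2) by (intro Cons.IH) auto
      moreover have "tuple (?\<tau> r') js ns' \<longleftrightarrow> tuple \<tau> js ns'" for r'
        using Cons.prems(2) by (intro tuple_cong) auto
      ultimately show ?thesis by simp
    qed
    also have "\<dots> \<longleftrightarrow> tuple \<tau> (i # js) ns"
      using Cons by (auto simp: denotes_def prefix_def)
    finally show ?thesis .
  qed
qed

definition tuple_registers :: "nat \<Rightarrow> nat list" where
  "tuple_registers a = [4..<4 + a]"

lemma tuple_registers:
  "registers (tuple_registers a)" "3 \<notin> set (tuple_registers a)" "length (tuple_registers a) = a"
  by (auto simp: tuple_registers_def registers_def)

text \<open>Register \<open>3\<close> keeps pointing to the beginning of the input.\<close>

definition search :: "nat \<Rightarrow> nat \<Rightarrow> token_action prog" where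
  "search d a = seqs [check d Skip [], load (tuple_registers a),
     Star (Seq (copy 0 3) (check d Arc (tuple_registers a))),
     copy 0 3, check d Skip [], skip_list, verify (tuple_registers a)]"

lemma check_Skip_exact:
  assumes "wf_inputs F" "num_operations F \<le> d" "\<tau> 0 = factored_tokens F @ r" "(\<tau>, \<tau>') \<in> tsem (check d Skip [])"
  shows "\<tau>' 0 = r \<and> unchanged {0, 1, 2} \<tau> \<tau>'"
proof -
  have "implements (check d Skip []) [] (factored_tokens F) (rel Skip F)"
    using assms by (intro check_correct) (auto simp: registers_def)
  then show ?thesis using assms(3,4) by (auto elim: implements_sound)
qed

lemma check_Skip_ex:
  assumes "wf_inputs F" "num_operations F \<le> d" "\<tau> 0 = factored_tokens F @ r"
  obtains \<tau>' where "(\<tau>, \<tau>') \<in> tsem (check d Skip [])" "\<tau>' 0 = r" "unchanged {0, 1, 2} \<tau> \<tau>'"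
proof -
  have "implements (check d Skip []) [] (factored_tokens F) (rel Skip F)"
    using assms by (intro check_correct) (auto simp: registers_def)
  then show ?thesis using assms(3) that
    by (elim implements_complete[of _ _ _ _ \<tau> r "[]" "[]"]) auto
qed

lemma search_sound:
  assumes F: "wf_inputs F" "num_operations F \<le> d"
    and ts: "ts = factored_tokens F @ list_tokens s @ list_tokens t"
    and run: "(\<lambda>_. ts, \<tau>) \<in> tsem (search d a)"
  shows "(s, t) \<in> (parcs (graph_of F))\<^sup>*"
proof -
  let ?is = "tuple_registers a"
  let ?R = "tsem (Seq (copy 0 3) (check d Arc ?is))"
  note regs = tuple_registers[of a]
  have disj: "set ?is \<inter> {0, 1, 2, 3} = {}" "0 \<notin> set ?is" "distinct ?is"
    using regs by (auto simp: registers_def)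
  obtain \<tau>1 \<tau>2 \<tau>3 \<tau>4 \<tau>5 where
    1: "(\<lambda>_. ts, \<tau>1) \<in> tsem (check d Skip [])" and
    2: "(\<tau>1, \<tau>2) \<in> tsem (load ?is)" and
    3: "(\<tau>2, \<tau>3) \<in> ?R\<^sup>*" and
    4: "(\<tau>3(0 := \<tau>3 3), \<tau>4) \<in> tsem (check d Skip [])" and
    5: "(\<tau>4, \<tau>5) \<in> tsem skip_list" and
    6: "(\<tau>5, \<tau>) \<in> tsem (verify ?is)"
    using run unfolding search_def by (simp add: relcomp_unfold) blast
  have "\<tau>1 0 = list_tokens s @ list_tokens t" "unchanged {0, 1, 2} (\<lambda>_. ts) \<tau>1"
    using check_Skip_exact[OF F _ 1] ts by auto
  then have \<tau>2: "tuple \<tau>2 ?is s" "\<tau>2 3 = ts"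
    using load_sound[OF _ disj(3,2) 2] disj regs(2) by (auto simp: unchanged_def)
  have "\<tau>3 3 = ts \<and> (\<exists>v. tuple \<tau>3 ?is v \<and> (s, v) \<in> (parcs (graph_of F))\<^sup>*)"
    using 3
  proof (induction rule: rtrancl_induct)
    case base
    then show ?case using \<tau>2 by blast
  next
    case (step \<rho> \<rho>')
    then obtain u where u: "\<rho> 3 = ts" "tuple \<rho> ?is u" "(s, u) \<in> (parcs (graph_of F))\<^sup>*" by blast
    from step(2) u(1) have c: "(\<rho>(0 := ts), \<rho>') \<in> tsem (check d Arc ?is)" by auto
    have imp: "implements (check d Arc ?is) ?is (factored_tokens F) (rel Arc F)"
      using F regs(1) by (rule check_correct)
    have "(\<rho>(0 := ts)) 0 = factored_tokens F @ list_tokens s @ list_tokens t" using ts by simp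
    then obtain u' v where res: "result ?is (list_tokens s @ list_tokens t) (\<rho>(0 := ts)) \<rho>'" and
      uv: "(u', v) \<in> rel Arc F" "tuple (\<rho>(0 := ts)) ?is u'" "tuple \<rho>' ?is v"
      using implements_sound[OF imp _ c] by blast
    have "tuple \<rho> ?is u'" using uv(2) disj by (subst tuple_cong[of _ _ "\<rho>(0 := ts)"]) auto
    then have "u' = u" using u(2) tuple_unique by blast
    moreover have "\<rho>' 3 = ts" using res regs(2) u(1) by (auto simp: unchanged_def)
    ultimately show ?case using uv u by (auto intro: rtrancl_into_rtrancl)
  qed
  then obtain v where v: "\<tau>3 3 = ts" "tuple \<tau>3 ?is v" "(s, v) \<in> (parcs (graph_of F))\<^sup>*" by blast
  then have \<tau>4: "\<tau>4 0 = list_tokens s @ list_tokens t" "unchanged {0, 1, 2} (\<tau>3(0 := \<tau>3 3)) \<tau>4"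
    using check_Skip_exact[OF F _ 4] ts by auto
  then have \<tau>5: "\<tau>5 = \<tau>4(0 := list_tokens t)" using 5 skip_list_exact by blast
  have "tuple \<tau>5 ?is t"
    using verify_iff[of \<tau>5 t "[]" ?is] 6 \<tau>5 disj(1) by auto
  moreover have "tuple \<tau>5 ?is v"
  proof -
    have "\<tau>5 i = \<tau>3 i" if "i \<in> set ?is" for i
      using that disj(1) \<tau>4(2) \<tau>5 by (auto simp: unchanged_def)
    then show ?thesis using v(2) tuple_cong[of ?is \<tau>5 \<tau>3 v] by blast
  qed
  ultimately have "v = t" using tuple_unique by blast
  with v show ?thesis by simp
qed

lemma search_complete:
  assumes F: "wf_inputs F" "num_operations F \<le> d"
    and ts: "ts = factored_tokens F @ list_tokens s @ list_tokens t"
    and reach: "(s, t) \<in> (parcs (graph_of F))\<^sup>*"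
  shows "\<exists>\<tau>. (\<lambda>_. ts, \<tau>) \<in> tsem (search d (length s))"
proof -
  let ?is = "tuple_registers (length s)"
  let ?R = "tsem (Seq (copy 0 3) (check d Arc ?is))"
  note regs = tuple_registers[of "length s"]
  have disj: "set ?is \<inter> {0, 1, 2, 3} = {}" "0 \<notin> set ?is" "distinct ?is"
    using regs by (auto simp: registers_def)
  obtain \<tau>1 where 1: "(\<lambda>_. ts, \<tau>1) \<in> tsem (check d Skip [])"
    and \<tau>1: "\<tau>1 0 = list_tokens s @ list_tokens t" "unchanged {0, 1, 2} (\<lambda>_. ts) \<tau>1"
    using check_Skip_ex[OF F, of "\<lambda>_. ts"] ts by blast
  obtain \<tau>2 where 2: "(\<tau>1, \<tau>2) \<in> tsem (load ?is)"
    using load_complete[of \<tau>1 s "list_tokens t" ?is] \<tau>1(1) disj(2) regs(3) by auto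
  have \<tau>2: "tuple \<tau>2 ?is s" "\<tau>2 3 = ts"
    using load_sound[of \<tau>1, OF \<tau>1(1) disj(3,2) 2] \<tau>1(2) disj regs(2) by (auto simp: unchanged_def)
  have "\<exists>\<tau>3. (\<tau>2, \<tau>3) \<in> ?R\<^sup>* \<and> \<tau>3 3 = ts \<and> tuple \<tau>3 ?is t"
    using reach
  proof (induction rule: rtrancl_induct)
    case base
    then show ?case using \<tau>2 by blast
  next
    case (step u v)
    then obtain \<rho> where \<rho>: "(\<tau>2, \<rho>) \<in> ?R\<^sup>*" "\<rho> 3 = ts" "tuple \<rho> ?is u" by blast
    have imp: "implements (check d Arc ?is) ?is (factored_tokens F) (rel Arc F)"
      using F regs(1) by (rule check_correct)
    have "tuple (\<rho>(0 := ts)) ?is u" using \<rho>(3) disj by (subst tuple_cong[of _ _ \<rho>]) auto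
    then obtain \<rho>' where \<rho>': "(\<rho>(0 := ts), \<rho>') \<in> tsem (check d Arc ?is)"
      "unchanged ({0, 1, 2} \<union> set ?is) (\<rho>(0 := ts)) \<rho>'" "tuple \<rho>' ?is v"
      using implements_complete[OF imp, of "\<rho>(0 := ts)" "list_tokens s @ list_tokens t" u v] ts step(2)
      by auto
    have "(\<rho>, \<rho>') \<in> ?R" using \<rho>'(1) \<rho>(2) by auto
    moreover have "\<rho>' 3 = ts" using \<rho>'(2) \<rho>(2) regs(2) by (auto simp: unchanged_def)
    ultimately show ?case using rtrancl_into_rtrancl[OF \<rho>(1)] \<rho>'(3) by blast
  qed
  then obtain \<tau>3 where 3: "(\<tau>2, \<tau>3) \<in> ?R\<^sup>*" "\<tau>3 3 = ts" "tuple \<tau>3 ?is t" by blast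
  obtain \<tau>4 where 4: "(\<tau>3(0 := \<tau>3 3), \<tau>4) \<in> tsem (check d Skip [])"
    and \<tau>4: "\<tau>4 0 = list_tokens s @ list_tokens t" "unchanged {0, 1, 2} (\<tau>3(0 := \<tau>3 3)) \<tau>4"
    using check_Skip_ex[OF F, of "\<tau>3(0 := \<tau>3 3)"] ts 3(2) by auto
  let ?\<tau>5 = "\<tau>4(0 := list_tokens t)"
  have 5: "(\<tau>4, ?\<tau>5) \<in> tsem skip_list" using skip_list_exact[of \<tau>4] \<tau>4(1) by blast
  have "?\<tau>5 i = \<tau>3 i" if "i \<in> set ?is" for i
    using that disj(1) \<tau>4(2) by (auto simp: unchanged_def)
  then have "tuple ?\<tau>5 ?is t" using 3(3) tuple_cong[of ?is ?\<tau>5 \<tau>3 t] by blast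
  then obtain \<tau> where 6: "(?\<tau>5, \<tau>) \<in> tsem (verify ?is)"
    using verify_iff[of ?\<tau>5 t "[]" ?is] disj(1) by auto
  have "(\<tau>3, \<tau>3(0 := \<tau>3 3)) \<in> tsem (copy 0 3)" by auto
  moreover have "(\<tau>2, \<tau>3) \<in> tsem (Star (Seq (copy 0 3) (check d Arc ?is)))" using 3(1) by simp
  ultimately have "(\<lambda>_. ts, \<tau>) \<in> tsem (search d (length s))"
    unfolding search_def seqs.simps sem.simps(3) using 1 2 4 5 6 by (intro relcompI)
  then show ?thesis by blast
qed

lemma pverts_graph_of:
  "v \<in> pverts (graph_of F) \<Longrightarrow> length v \<le> Suc (num_operations F) \<and> set v \<subseteq> labels F"
proof (induction F arbitrary: v)
  case (Cartesian F H)
  then obtain a b where "v = a @ b" "a \<in> pverts (graph_of F)" "b \<in> pverts (graph_of H)"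
    by (auto simp: cartesian_product_def)
  with Cartesian.IH(1)[of a] Cartesian.IH(2)[of b] show ?case by (auto simp: labels_def)
next
  case (Tensor F H)
  then obtain a b where "v = a @ b" "a \<in> pverts (graph_of F)" "b \<in> pverts (graph_of H)"
    by (auto simp: tensor_product_def)
  with Tensor.IH(1)[of a] Tensor.IH(2)[of b] show ?case by (auto simp: labels_def)
next
  case (Union F H)
  then consider "v \<in> pverts (graph_of F)" | "v \<in> pverts (graph_of H)" by (auto simp: graph_union_def)
  then show ?case
  proof cases
    case 1
    then show ?thesis using Union.IH(1)[of v] by (auto simp: labels_def)
  next
    case 2
    then show ?thesis using Union.IH(2)[of v] by (auto simp: labels_def)
  qed
qed (auto simp: labels_def)

lemma reachable_iff:
  assumes "wf_inputs F" "s \<in> pverts (graph_of F)" "t \<in> pverts (graph_of F)"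
  shows "s \<rightarrow>\<^sup>*\<^bsub>with_proj (graph_of F)\<^esub> t \<longleftrightarrow> (s, t) \<in> (parcs (graph_of F))\<^sup>*"
proof
  assume "s \<rightarrow>\<^sup>*\<^bsub>with_proj (graph_of F)\<^esub> t"
  then show "(s, t) \<in> (parcs (graph_of F))\<^sup>*"
    using reachable_rtranclI by fastforce
next
  assume "(s, t) \<in> (parcs (graph_of F))\<^sup>*"
  then have "(s, t) \<in> rtrancl_on (pverts (graph_of F)) (parcs (graph_of F))"
    using assms parcs_subset[OF assms(1)] by (intro rtrancl_consistent_rtrancl_on) auto
  then show "s \<rightarrow>\<^sup>*\<^bsub>with_proj (graph_of F)\<^esub> t" by (simp add: reachable_def)
qed

lemma reachability_in_NL:
  "\<exists>L\<in>NL. \<forall>n F s t. reachability_instance n k F s t \<longrightarrow>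
     (encode F s t \<in> L \<longleftrightarrow> s \<rightarrow>\<^sup>*\<^bsub>with_proj (graph_of F)\<^esub> t)"
proof -
  obtain L where "L \<in> NL" and L: "\<And>ts. word ts \<in> L \<longleftrightarrow>
      (\<exists>\<tau>. (\<lambda>_. ts, \<tau>) \<in> tsem (choices (map (search k) [0..<Suc k])))"
    using token_prog_in_NL by blast
  have "encode F s t \<in> L \<longleftrightarrow> s \<rightarrow>\<^sup>*\<^bsub>with_proj (graph_of F)\<^esub> t"
    if inst: "reachability_instance n k F s t" for n F s t
  proof -
    let ?ts = "factored_tokens F @ list_tokens s @ list_tokens t"
    have F: "wf_inputs F" "num_operations F \<le> k" and k: "Suc (num_operations F) \<le> k"
      and st: "s \<in> pverts (graph_of F)" "t \<in> pverts (graph_of F)"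
      using inst by (auto simp: reachability_instance_def factored_graph_def has_complexity_def)
    have "length s < Suc k" using pverts_graph_of[OF st(1)] k by simp
    moreover have "encode F s t \<in> L \<longleftrightarrow> (\<exists>a<Suc k. \<exists>\<tau>. (\<lambda>_. ?ts, \<tau>) \<in> tsem (search k a))"
      using L[of ?ts] by (auto simp: encode_def word_def sem_choices simp del: upt_Suc)
    ultimately show ?thesis
      unfolding reachable_iff[OF F(1) st]
      using search_sound[OF F refl] search_complete[OF F refl] by blast
  qed
  with \<open>L \<in> NL\<close> show ?thesis by blast
qed

lemma length_binary_le: "length (binary n) \<le> n"
proof (induction n rule: less_induct)
  case (less n)
  show ?case
  proof (cases "n = 0")
    case False
    then have "length (binary (n div 2)) \<le> n div 2" by (intro less.IH) simp
    then show ?thesis using False binary.simps[of n] by simp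
  qed (simp add: binary.simps)
qed

lemma length_list_tokens_le:
  "(\<And>v. v \<in> set ns \<Longrightarrow> v < B) \<Longrightarrow> length (list_tokens ns) \<le> length ns * (B + 1) + 1"
proof (induction ns)
  case (Cons v ns)
  then have "length (number_tokens v) \<le> B + 1"
    using length_binary_le[of v] by (force simp: number_tokens_def)
  with Cons show ?case by (force simp: list_tokens_def)
qed (simp add: list_tokens_def)

lemma length_input_tokens_le:
  assumes "pair_fin_digraph G" "card (pverts G) \<le> n" "\<And>v. v \<in> pverts G \<Longrightarrow> v < B"
  shows "length (factored_tokens (Input G)) \<le> 3 * n\<^sup>2 * (B + 1) + 3"
proof -
  have set_vl: "set (vertex_list G) = pverts G" by (rule set_vertex_list[OF assms(1)])
  have vl: "length (vertex_list G) \<le> n" using assms(2) by (simp add: vertex_list_def)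
  have "length (arc_list G) \<le> length (vertex_list G) * length (vertex_list G)"
    unfolding arc_list_def by (metis length_filter_le length_product)
  also have "\<dots> \<le> n * n" using vl by (intro mult_mono) auto
  finally have al: "length (arc_list G) \<le> n * n" .
  have "length (flatten (arc_list G)) = 2 * length (arc_list G)"
    unfolding flatten_def by (induction "arc_list G") (auto simp: length_concat comp_def split_beta sum_list_triv)
  moreover have "v < B" if "v \<in> set (flatten (arc_list G))" for v
    using that assms(3) set_arc_list[OF assms(1)] set_vl by (auto simp: flatten_def arc_list_def)
  ultimately have "length (list_tokens (flatten (arc_list G))) \<le> 2 * (n * n) * (B + 1) + 1"
    using length_list_tokens_le[of "flatten (arc_list G)" B] al
  proof -
    assume a: "length (flatten (arc_list G)) = 2 * length (arc_list G)"
      and "\<And>v. v \<in> set (flatten (arc_list G)) \<Longrightarrow> v < B"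
    then have "length (list_tokens (flatten (arc_list G))) \<le> length (flatten (arc_list G)) * (B + 1) + 1"
      by (intro length_list_tokens_le)
    also have "\<dots> \<le> 2 * (n * n) * (B + 1) + 1"
      unfolding a using al by (intro add_mono mult_mono) auto
    finally show ?thesis .
  qed
  moreover have "length (list_tokens (vertex_list G)) \<le> n * n * (B + 1) + 1"
  proof -
    have "length (list_tokens (vertex_list G)) \<le> length (vertex_list G) * (B + 1) + 1"
      using assms(3) set_vl by (intro length_list_tokens_le) auto
    also have "\<dots> \<le> n * n * (B + 1) + 1"
    proof -
      have "length (vertex_list G) \<le> n * n" using vl by (cases n) auto
      then show ?thesis by (intro add_mono mult_mono) auto
    qed
    finally show ?thesis .
  qed
  moreover have "factored_tokens (Input G) =
      InputT # list_tokens (vertex_list G) @ list_tokens (flatten (arc_list G))"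
    by (simp add: flatten_def)
  ultimately show ?thesis by (simp add: power2_eq_square algebra_simps)
qed

lemma length_factored_tokens_le:
  assumes "wf_inputs F" "\<forall>G\<in>inputs F. card (pverts G) \<le> n" "\<And>v. v \<in> labels F \<Longrightarrow> v < B"
  shows "length (factored_tokens F) + 1 \<le> Suc (num_operations F) * (3 * n\<^sup>2 * (B + 1) + 4)"
  using assms
proof (induction F)
  case (Input G)
  then show ?case using length_input_tokens_le[of G n B] by (simp add: labels_def)
qed (force simp: labels_def algebra_simps)+

lemma card_inputs: "finite (inputs F) \<and> card (inputs F) \<le> Suc (num_operations F)"
proof (induction F)
  case (Cartesian F H)
  then show ?case using card_Un_le[of "inputs F" "inputs H"] by simp
next
  case (Tensor F H)
  then show ?case using card_Un_le[of "inputs F" "inputs H"] by simp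
next
  case (Union F H)
  then show ?case using card_Un_le[of "inputs F" "inputs H"] by simp
qed simp

lemma length_encode:
  assumes "reachability_instance n k F s t"
  shows "1 \<le> k" "1 \<le> n" "1 \<le> length (encode F s t)" "length (encode F s t) \<le> 48 * k\<^sup>2 * n ^ 3"
proof -
  let ?B = "k * n"
  have F: "wf_inputs F" "\<forall>G\<in>inputs F. card (pverts G) \<le> n" and k: "Suc (num_operations F) = k"
    and st: "s \<in> pverts (graph_of F)" "t \<in> pverts (graph_of F)" and lab: "labels F = {..<card (labels F)}"
    using assms by (auto simp: reachability_instance_def factored_graph_def has_complexity_def)
  show k1: "1 \<le> k" using k by simp
  have "card (labels F) \<le> (\<Sum>G\<in>inputs F. card (pverts G))"
    unfolding labels_def using card_inputs by (intro card_UN_le) blast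
  also have "\<dots> \<le> card (inputs F) * n" using F(2) sum_bounded_above[of "inputs F" _ n] by simp
  also have "\<dots> \<le> ?B" using card_inputs[of F] k by simp
  finally have card_B: "card (labels F) \<le> ?B" .
  have B: "v < ?B" if "v \<in> labels F" for v
  proof -
    have "v < card (labels F)" using that by (subst (asm) lab) simp
    then show ?thesis using card_B by simp
  qed
  have "length (list_tokens v) \<le> k * (?B + 1) + 1" if "v \<in> pverts (graph_of F)" for v
  proof -
    have "length (list_tokens v) \<le> length v * (?B + 1) + 1"
      using pverts_graph_of[OF that] B by (intro length_list_tokens_le) auto
    also have "\<dots> \<le> k * (?B + 1) + 1" using pverts_graph_of[OF that] k by (intro add_mono mult_mono) auto
    finally show ?thesis .
  qed
  note lists = this[OF st(1)] this[OF st(2)]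
  have tokens: "length (factored_tokens F) + 1 \<le> k * (3 * n\<^sup>2 * (?B + 1) + 4)"
    using length_factored_tokens_le[OF F B] k by simp
  have encode: "length (encode F s t) =
      3 * (length (factored_tokens F) + length (list_tokens s) + length (list_tokens t))"
    using length_word[of "factored_tokens F @ list_tokens s @ list_tokens t"]
    by (simp add: encode_def word_def)
  then show "1 \<le> length (encode F s t)" by (simp add: list_tokens_def)
  have "\<exists>G\<in>inputs F. pverts G \<noteq> {}"
  proof -
    have "labels F \<noteq> {} \<or> s = []" using pverts_graph_of[OF st(1)] by auto
    moreover have "[] \<notin> pverts (graph_of F)"
      by (induction F) (auto simp: cartesian_product_def tensor_product_def graph_union_def)
    ultimately show ?thesis using st(1) by (auto simp: labels_def)
  qed
  then obtain G where G: "G \<in> inputs F" "pverts G \<noteq> {}" by blast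
  have "finite (pverts G)"
    using F(1) G(1) by (auto simp: pair_fin_digraph_def pair_fin_digraph_axioms_def)
  then have "0 < card (pverts G)" using G(2) by (simp add: card_gt_0_iff)
  then show n1: "1 \<le> n" using F(2) G(1) by fastforce
  have "?B + 1 \<le> 2 * ?B" "1 \<le> ?B" using k1 n1 by auto
  have "k * (3 * n\<^sup>2 * (?B + 1) + 4) \<le> k * (3 * n\<^sup>2 * (2 * ?B) + 4 * (k * n ^ 3))"
  proof (intro mult_mono add_mono)
    have "1 \<le> k * n ^ 3" using k1 n1 by simp
    then show "4 \<le> 4 * (k * n ^ 3)" by simp
  qed (use \<open>?B + 1 \<le> 2 * ?B\<close> in auto)
  also have "\<dots> = 10 * (k\<^sup>2 * n ^ 3)" by (simp add: power2_eq_square power3_eq_cube algebra_simps)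
  finally have 1: "length (factored_tokens F) \<le> 10 * (k\<^sup>2 * n ^ 3)" using tokens by linarith
  have "k * (?B + 1) + 1 \<le> k * (2 * ?B) + k * ?B"
    using \<open>?B + 1 \<le> 2 * ?B\<close> \<open>1 \<le> ?B\<close> k1 by (intro add_mono mult_mono) auto
  also have "\<dots> = 3 * k\<^sup>2 * n" by (simp add: power2_eq_square algebra_simps)
  also have "\<dots> \<le> 3 * (k\<^sup>2 * n ^ 3)" using n1 by (simp add: self_le_power)
  finally have 2: "k * (?B + 1) + 1 \<le> 3 * (k\<^sup>2 * n ^ 3)" .
  have "length (encode F s t) \<le> 3 * (10 * X + 3 * X + 3 * X)" if "X = k\<^sup>2 * n ^ 3" for X
    unfolding encode using 1 le_trans[OF lists(1) 2] le_trans[OF lists(2) 2] that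
    by (intro mult_le_mono add_mono) simp_all
  then have "length (encode F s t) \<le> 48 * (k\<^sup>2 * n ^ 3)" by fastforce
  then show "length (encode F s t) \<le> 48 * k\<^sup>2 * n ^ 3" by (simp add: mult.assoc)
qed

lemma bigo_powr_bound:
  assumes "(\<lambda>n. real (T n)) \<in> O(\<lambda>n. real n powr C)"
  shows "\<exists>D\<ge>0. \<forall>n\<ge>1. real (T n) \<le> D * real n powr max C 0"
proof -
  obtain c where c: "c > 0" "eventually (\<lambda>n. norm (real (T n)) \<le> c * norm (real n powr C)) sequentially"
    using landau_o.bigE[OF assms] by blast
  then obtain N where N: "\<And>n. n \<ge> N \<Longrightarrow> real (T n) \<le> c * real n powr C"
    by (auto simp: eventually_sequentially)
  let ?D = "c + (\<Sum>i<N. real (T i))"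
  have "real (T n) \<le> ?D * real n powr max C 0" if n: "n \<ge> 1" for n
  proof -
    have one: "1 \<le> real n powr max C 0" using n by (intro ge_one_powr_ge_zero) auto
    have sum: "0 \<le> (\<Sum>i<N. real (T i))" by (intro sum_nonneg) auto
    show ?thesis
    proof (cases "n < N")
      case True
      then have "real (T n) \<le> (\<Sum>i<N. real (T i))" by (intro member_le_sum) auto
      also have "\<dots> \<le> ?D * 1" using c by simp
      also have "\<dots> \<le> ?D * real n powr max C 0" using one c sum by (intro mult_left_mono) auto
      finally show ?thesis .
    next
      case False
      then have "real (T n) \<le> c * real n powr C" using N by simp
      also have "\<dots> \<le> ?D * real n powr max C 0"
        using c sum n by (intro mult_mono powr_mono) auto
      finally show ?thesis .
    qed
  qed
  moreover have "0 \<le> ?D" using c by (intro add_nonneg_nonneg sum_nonneg) auto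
  ultimately show ?thesis by blast
qed

theorem theorem1p4:
  assumes "\<not> reachability_fixed_parameter_tractable"
  shows "\<not> (\<exists>C :: real. NL \<subseteq> DTIME (\<lambda>n. real n powr C))"
proof
  assume "\<exists>C :: real. NL \<subseteq> DTIME (\<lambda>n. real n powr C)"
  then obtain C :: real where C: "NL \<subseteq> DTIME (\<lambda>n. real n powr C)" by blast
  let ?E = "max C 0"
  have "\<exists>c. \<exists>M :: (nat, nat) tm. turing_machine M \<and> deterministic M \<and>
      solves_reachability_in_time M k (\<lambda>n. c * real n powr (3 * ?E))" for k
  proof -
    obtain L where "L \<in> NL" and L: "\<And>n F s t. reachability_instance n k F s t \<Longrightarrow>
        encode F s t \<in> L \<longleftrightarrow> s \<rightarrow>\<^sup>*\<^bsub>with_proj (graph_of F)\<^esub> t"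
      using reachability_in_NL by blast
    then have "L \<in> DTIME (\<lambda>n. real n powr C)" using C by blast
    then obtain M :: "(nat, nat) tm" and T where M: "turing_machine M" "deterministic M"
      and T: "(\<lambda>n. real (T n)) \<in> O(\<lambda>n. real n powr C)"
      and run: "\<And>x. (\<exists>j\<le>T (length x). halts_in M x j) \<and> (x \<in> L \<longleftrightarrow> accepts M x)"
      unfolding DTIME_def by blast
    obtain D where D: "D \<ge> 0" "\<And>n. n \<ge> 1 \<Longrightarrow> real (T n) \<le> D * real n powr ?E"
      using bigo_powr_bound[OF T] by blast
    let ?c = "D * (48 * real k ^ 2) powr ?E"
    have time: "real (T (length (encode F s t))) \<le> ?c * real n powr (3 * ?E)"
      if inst: "reachability_instance n k F s t" for n F s t
    proof -
      note len = length_encode[OF inst]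
      have "real (length (encode F s t)) \<le> real (48 * k\<^sup>2 * n ^ 3)"
        using len(4) by (simp only: of_nat_le_iff)
      then have "real (length (encode F s t)) \<le> 48 * real k ^ 2 * real n ^ 3" by simp
      then have "real (length (encode F s t)) powr ?E \<le> (48 * real k ^ 2 * real n ^ 3) powr ?E"
        by (intro powr_mono2) auto
      also have "\<dots> = (48 * real k ^ 2) powr ?E * real n powr (3 * ?E)"
      proof -
        have cube: "real n ^ 3 = real n powr 3" using len(2) by simp
        have "(real n ^ 3) powr ?E = real n powr (3 * ?E)" unfolding cube powr_powr ..
        then show ?thesis by (simp add: powr_mult)
      qed
      finally have "D * real (length (encode F s t)) powr ?E \<le>
          D * ((48 * real k ^ 2) powr ?E * real n powr (3 * ?E))"
        using D(1) by (rule mult_left_mono)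
      with D(2)[OF len(3)] show ?thesis by (simp add: mult.assoc)
    qed
    have "solves_reachability_in_time M k (\<lambda>n. ?c * real n powr (3 * ?E))"
      unfolding solves_reachability_in_time_def
    proof (intro allI impI conjI)
      fix n F s t assume inst: "reachability_instance n k F s t"
      obtain j where j: "j \<le> T (length (encode F s t))" "halts_in M (encode F s t) j"
        using run by blast
      then have "real j \<le> real (T (length (encode F s t)))" by simp
      also have "\<dots> \<le> ?c * real n powr (3 * ?E)" by (rule time[OF inst])
      finally show "\<exists>j. real j \<le> ?c * real n powr (3 * ?E) \<and> halts_in M (encode F s t) j"
        using j(2) by blast
      show "accepts M (encode F s t) \<longleftrightarrow> s \<rightarrow>\<^sup>*\<^bsub>with_proj (graph_of F)\<^esub> t"
        using run L[OF inst] by blast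
    qed
    with M show ?thesis by blast
  qed
  then have "\<exists>g. \<forall>k. \<exists>M :: (nat, nat) tm. turing_machine M \<and> deterministic M \<and>
      solves_reachability_in_time M k (\<lambda>n. g k * real n powr (3 * ?E))"
    by (intro choice) blast
  then have reachability_fixed_parameter_tractable
    unfolding reachability_fixed_parameter_tractable_def by blast
  with assms show False by blast
qed

end
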